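(* Let $k\geq 2$ be an integer. Let $\alpha$ be the solution to the equation $f(x)=0$. Assume $f\in C^{k+1}(I)$, where $I$ is an open interval containing $\alpha$, and assume also that $f'(\alpha)\neq 0$, in addition to $f(\alpha)=0$. Let $x_0,x_1,\ldots,x_k$ be distinct initial approximations to $\alpha$, and generate $x_n$, $n=k+1,k+2,\ldots,$ via $$x_{n+1}=x_n-\frac{f(x_n)}{p'_{n,k}(x_n)},\quad n=k,k+1,\ldots,$$ where $p_{n,k}(x)$ is the polynomial of interpolation to $f(x)$ at the points $x_n,x_{n-1},\ldots,x_{n-k}$. Write $\epsilon_n=x_n-\alpha$ for all $n$. Then, provided $x_0,x_1,\ldots,x_k$ are in $I$ and sufficiently close to $\alpha$, the following hold. 1. If $f^{(k+1)}(\alpha)\neq 0$, the sequence $\{x_n\}$ converges to $\alpha$, and $$\lim_{n\to\infty}\frac{\epsilon_{n+1}}{\prod_{i=0}^k\epsilon_{n-i}}=\frac{(-1)^{k+1}}{(k+1)!}\,\frac{f^{(k+1)}(\alpha)}{f'(\alpha)}\equiv L.$$ The order of convergence is $s_k$, $1<s_k<2$, where $s_k$ is the only positive root of the equation $s^{k+1}=\sum_{i=0}^k s^i$ and satisfies $$2-2^{-k-1}e<s_k<2-2^{-k-1}\quad\text{for } k\geq 2;\qquad s_k<s_{k+1};\qquad \lim_{k\to\infty}s_k=2,$$ where $e$ is the base of natural logarithms, and $$\lim_{n\to\infty}\frac{|\epsilon_{n+1}|}{|\epsilon_n|^{s_k}}=|L|^{(s_k-1)/k}.$$ 2. If $f(x)$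 is a polynomial of degree at most $k$, the sequence $\{x_n\}$ converges to $\alpha$, and $$\lim_{n\to\infty}\frac{\epsilon_{n+1}}{\epsilon_n^2}=\frac{f''(\alpha)}{2f'(\alpha)}.$$ Thus $\{x_n\}$ converges of order $2$ if $f''(\alpha)\neq 0$, and of order greater than $2$ if $f''(\alpha)=0$.
   Context: Here $f$ is a real-valued function of a real variable. The polynomial $p_{n,k}(x)$ is the polynomial of degree at most $k$ satisfying $p_{n,k}(x_i)=f(x_i)$ for $i=n,n-1,\ldots,n-k$, and $p'_{n,k}$ is its derivative. In Newton form, $$p_{n,k}(x)=f(x_n)+\sum_{i=1}^{k}f[x_n,x_{n-1},\ldots,x_{n-i}]\prod_{j=0}^{i-1}(x-x_{n-j}),$$ so that $$p'_{n,k}(x_n)=f[x_n,x_{n-1}]+\sum_{i=2}^{k}f[x_n,x_{n-1},\ldots,x_{n-i}]\prod_{j=1}^{i-1}(x_n-x_{n-j}).$$ The divided differences are defined recursively by $f[x_i]=f(x_i)$, $f[x_i,x_j]=\frac{f[x_i]-f[x_j]}{x_i-x_j}$ for $x_i\neq x_j$, and $$f[x_i,x_{i+1},\ldots,x_m]=\frac{f[x_i,\ldots,x_{m-1}]-f[x_{i+1},\ldots,x_m]}{x_i-x_m},\quad x_i\neq x_m,$$ for $m>i+1$; they are symmetric functions of their arguments. The phrase "order of convergence" has its usual meaning for sequences $x_n\to\alpha$, in terms of the asymptotic behavior of $|\epsilon_{n+1}|$ relative to powers of $|\epsilon_n|$; the paper uses "$\{x_n\}$ converges of order greater than $1$" as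 equivalent to $\lim_{n\to\infty}\epsilon_{n+1}/\epsilon_n=0$. *)

theory Defs
  imports "HOL-Analysis.Analysis" "HOL-Computational_Algebra.Polynomial"
begin

text \<open>For open \<open>S\<close> this depends only on the restriction of \<open>f\<close> to \<open>S\<close>, although \<open>deriv\<close> is total.\<close>

definition Ck_on :: "nat \<Rightarrow> (real \<Rightarrow> real) \<Rightarrow> real set \<Rightarrow> bool" where
  "Ck_on m f S \<longleftrightarrow>
     (\<forall>j<m. \<forall>t\<in>S. (deriv ^^ j) f differentiable (at t)) \<and> continuous_on S ((deriv ^^ m) f)"

text \<open>The interpolation polynomial $p_{n,k}$, for \<open>n \<ge> k\<close>. It is determined only if the nodes
  $x_n, \ldots, x_{n-k}$ are distinct, see \<open>interp_poly_ex1\<close>.\<close>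

definition interp_poly :: "(real \<Rightarrow> real) \<Rightarrow> (nat \<Rightarrow> real) \<Rightarrow> nat \<Rightarrow> nat \<Rightarrow> real poly" where
  "interp_poly f x n k =
     (THE p. degree p \<le> k \<and> (\<forall>i\<in>{n-k..n}. poly p (x i) = f (x i)))"

lemma interp_poly_ex1:
  assumes "k \<le> n" and "inj_on x {n-k..n}"
  shows "\<exists>!p. degree p \<le> k \<and> (\<forall>i\<in>{n-k..n}. poly p (x i) = f (x i :: real))"
proof -
  let ?N = "x ` {n-k..n}"
  have card: "card ?N = Suc k"
    using assms by (simp add: card_image)
  have ex: "\<exists>p. degree p \<le> card A - 1 \<and> (\<forall>t\<in>A. poly p t = f t)" if "finite A" for A
    using that
  proof (induction A rule: finite_induct)
    case empty
    show ?case by (auto intro: exI[of _ 0])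
  next
    case (insert a A)
    then obtain p where p: "degree p \<le> card A - 1" "\<forall>t\<in>A. poly p t = f t" by blast
    define w where "w = (\<Prod>t\<in>A. [:- t, 1:])"
    have dw: "degree w = card A"
      unfolding w_def by (subst degree_prod_eq_sum_degree) auto
    have w0: "poly w t = 0" if "t \<in> A" for t
      using that insert.hyps by (auto simp: w_def poly_prod)
    have wa: "poly w a \<noteq> 0"
      using insert.hyps by (auto simp: w_def poly_prod)
    define q where "q = p + smult ((f a - poly p a) / poly w a) w"
    have "degree q \<le> card A"
      unfolding q_def using p(1) dw
      by (intro degree_add_le) (auto intro: le_trans[OF degree_smult_le])
    moreover have "\<forall>t\<in>insert a A. poly q t = f t"
      using p(2) w0 wa by (auto simp: q_def)
    ultimately show ?case
      using insert.hyps by auto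
  qed
  show ?thesis
  proof (rule ex_ex1I)
    show "\<exists>p. degree p \<le> k \<and> (\<forall>i\<in>{n-k..n}. poly p (x i) = f (x i))"
      using ex[of ?N] card by auto
  next
    fix p q
    assume p: "degree p \<le> k \<and> (\<forall>i\<in>{n-k..n}. poly p (x i) = f (x i))"
      and q: "degree q \<le> k \<and> (\<forall>i\<in>{n-k..n}. poly q (x i) = f (x i))"
    show "p = q"
    proof (rule ccontr)
      assume "p \<noteq> q"
      then have nz: "p - q \<noteq> 0" by simp
      have "?N \<subseteq> {t. poly (p - q) t = 0}"
        using p q by auto
      then have "Suc k \<le> card {t. poly (p - q) t = 0}"
        using card_mono[OF poly_roots_finite[OF nz]] card by metis
      also have "\<dots> \<le> degree (p - q)"
        using nz by (rule card_poly_roots_bound)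
      also have "\<dots> \<le> k"
        using p q by (intro degree_diff_le) auto
      finally show False by simp
    qed
  qed
qed

text \<open>The iteration does not break down: as long as $f(x_n) \neq 0$, the nodes of $p_{n,k}$ are
  distinct. If $f(x_n) = 0$ then $x_{n+1} = x_n$ irrespective of the
  denominator, so a terminating iteration is continued as a constant sequence.\<close>

definition secant_iteration :: "(real \<Rightarrow> real) \<Rightarrow> nat \<Rightarrow> (nat \<Rightarrow> real) \<Rightarrow> bool" where
  "secant_iteration f k x \<longleftrightarrow>
     (\<forall>n\<ge>k. (f (x n) \<noteq> 0 \<longrightarrow> inj_on x {n-k..n}) \<and>
        x (Suc n) = x n - f (x n) / poly (pderiv (interp_poly f x n k)) (x n))"

text \<open>Since \<open>C > 0\<close> and \<open>a / 0 = 0\<close>, the limit forces $x_n \neq \alpha$ for all large \<open>n\<close>.\<close>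

definition converges_with_order :: "(nat \<Rightarrow> real) \<Rightarrow> real \<Rightarrow> real \<Rightarrow> bool" where
  "converges_with_order x \<alpha> s \<longleftrightarrow> x \<longlonglongrightarrow> \<alpha> \<and>
     (\<exists>C>0. (\<lambda>n. \<bar>x (Suc n) - \<alpha>\<bar> / \<bar>x n - \<alpha>\<bar> powr s) \<longlonglongrightarrow> C)"

definition secant_order :: "nat \<Rightarrow> real" where
  "secant_order k = (THE s. s > 0 \<and> s ^ (k + 1) = (\<Sum>i\<le>k. s ^ i))"

end

theory Submission
  imports Defs
begin

text \<open>Write $\epsilon_n = x_n - \alpha$ and $\pi_n = \prod_{i=1}^k (x_n - x_{n-i})$. Everything rests on two
remainder formulas. Repeated use of Rolle's theorem gives
$f'(x_n) - p_{n,k}'(x_n) = F_n \pi_n$ with $F_n = f^{(k+1)}(\xi)/(k+1)!$, and Taylor expansion at $x_n$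
gives $\epsilon_n f'(x_n) - f(x_n) = G_n \epsilon_n^2$ with $G_n = f''(\zeta)/2$; both intermediate
points can be taken in any interval that contains the nodes and $\alpha$. Substituted into the iteration, they yield
\[ \epsilon_{n+1} = \epsilon_n \, \frac{G_n \epsilon_n - F_n \pi_n}{f'(x_n) - F_n \pi_n}. \]
In a small ball around $\alpha$ the fraction is at most $1/2$ in modulus, so the ball is invariant and
the errors at least halve in each step (\<open>secant_iteration_local_contraction\<close>).

For the error quotient, the fraction tends to $0$, so $\epsilon_n/\epsilon_{n-i} \to 0$ for each
$i \geq 1$ and therefore $\pi_n / \prod_{i=1}^k \epsilon_{n-i} \to (-1)^k$. Dividing the recursion by
$\prod_{i=0}^k \epsilon_{n-i}$ shows that $R_n = \epsilon_{n+1} / \prod_{i=0}^k \epsilon_{n-i}$ satisfies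
$R_n = a_n R_{n-1} + c_n$ with $a_n \to 0$ and $c_n \to L$: the Newton term $G_n \epsilon_n^2$ is
negligible because it carries the additional factor $\epsilon_{n-k-1}$. Hence $R_n \to L$
(\<open>secant_error_quotient_limit\<close>).

For the order, take logarithms: $u_n = \ln|\epsilon_n|$ satisfies
$u_{n+1} - \sum_{i=0}^k u_{n-i} \to \ln|L|$. Dividing the characteristic polynomial
$z^{k+1} - \sum_{i=0}^k z^i$ by its dominant factor $z - s_k$ leaves coefficients
$1 = b_0 > b_1 > \dots > b_k > 0$, and $v_n = u_{n+1} - s_k u_n$ satisfies
$\sum_{i=0}^k b_i v_{n-i} \to \ln|L|$. By the theorem of Enestrom and Kakeya a polynomial with such
coefficients is stable; the real-variable counterpart
\<open>decreasing_recurrence_tendsto_0\<close> gives $v_n \to \ln|L| / \sum_i b_i = \ln|L|\,(s_k-1)/k$,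
which is the asserted limit after exponentiation (\<open>order_from_product_recurrence\<close>).

If $f$ is a polynomial of degree at most $k$, it is its own interpolation polynomial and the iteration is
Newton's method, whose error is governed by the factorisation
$(X - \alpha) P' - P = (X - \alpha)^2 Q$; the order is $2$ plus the multiplicity of $\alpha$ as a root of
$Q$ (\<open>newton_order_polynomial\<close>). The case $Q = 0$, in which $f$ is linear, terminates after
one step and is excluded by $x_n \neq \alpha$.\<close>

section \<open>The characteristic equation\<close>

text \<open>After division by $t^{k+1}$ the characteristic polynomial becomes $1 - \sum_{j=1}^{k+1} t^{-j}$, which is
strictly increasing in $t > 0$; hence it changes sign at most once there. This gives
uniqueness of the positive root, and lower bounds for it from negative values.\<close>

lemma char_poly_sign_mono:
  fixes a b :: real
  assumes "0 < a" "a < b" "(\<Sum>i\<le>k. a ^ i) \<le> a ^ (k + 1)"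
  shows "(\<Sum>i\<le>k. b ^ i) < b ^ (k + 1)"
proof -
  define r where "r = b / a"
  have r: "r > 1" "b = a * r" using assms by (auto simp: r_def)
  have "(\<Sum>i\<le>k. b ^ i) < (\<Sum>i\<le>k. a ^ i * r ^ (k + 1))"
  proof (rule sum_strict_mono)
    fix i assume "i \<in> {..k}"
    then have "r ^ i < r ^ (k + 1)" using r(1) by (intro power_strict_increasing) auto
    then show "b ^ i < a ^ i * r ^ (k + 1)"
      using assms(1) by (simp add: r(2) power_mult_distrib)
  qed auto
  also have "\<dots> = (\<Sum>i\<le>k. a ^ i) * r ^ (k + 1)"
    by (simp add: sum_distrib_right)
  also have "\<dots> \<le> a ^ (k + 1) * r ^ (k + 1)"
    using assms(3) r(1) by (intro mult_right_mono) auto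
  also have "\<dots> = b ^ (k + 1)" by (simp add: r(2) power_mult_distrib)
  finally show ?thesis .
qed

text \<open>The geometric sum turns the characteristic equation into $s^{k+1} (2 - s) = 1$ for $s \neq 1$. This form
shows how close the root is to $2$.\<close>

lemma char_poly_telescope:
  fixes t :: real
  shows "(t - 1) * (t ^ (k + 1) - (\<Sum>i\<le>k. t ^ i)) = 1 - t ^ (k + 1) * (2 - t)"
proof -
  have "(t - 1) * (\<Sum>i\<le>k. t ^ i) = t ^ (k + 1) - 1"
    by (induction k) (simp_all add: algebra_simps)
  then show ?thesis by (simp add: algebra_simps)
qed

text \<open>By the telescoped form, it suffices that $t^{k+1}(2-t) > 1$, which for this $t$ reads
$e \, (1 - e/2^{k+2})^{k+1} > 1$. Bernoulli's inequality together with $(k+1)/2^{k+2} \leq 3/16$ and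
$5/2 \leq e \leq 3$ bounds the left-hand side from below by $35/32$.\<close>

lemma char_poly_neg_at_lower_bound:
  assumes "k \<ge> 2"
  defines "t \<equiv> 2 - exp 1 / 2 ^ (k + 1) :: real"
  shows "1 < t" "t ^ (k + 1) < (\<Sum>i\<le>k. t ^ i)"
proof -
  have e: "exp 1 \<le> (3::real)" "5 / 2 \<le> exp (1::real)"
    using exp_le exp_lower_Taylor_quadratic[of "1::real"] by auto
  have "(2::real) ^ 3 \<le> 2 ^ (k + 1)" using assms by (intro power_increasing) auto
  then have "exp 1 / 2 ^ (k + 1) \<le> (3::real) / 8"
    using e by (intro frac_le) auto
  then show t1: "1 < t" unfolding t_def by linarith
  have kk: "16 * real (k + 1) \<le> 3 * 2 ^ (k + 2)"
    using assms(1)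
  proof (induction k rule: dec_induct)
    case (step n)
    have "(2::real) ^ 4 \<le> 2 ^ (n + 2)" using step(1) by (intro power_increasing) auto
    then show ?case using step by simp
  qed simp
  let ?h = "exp 1 / 2 ^ (k + 2) :: real"
  have "real (k + 1) * ?h \<le> 3 / 16 * exp 1"
    using mult_right_mono[OF kk, of "exp 1 / (16 * 2 ^ (k + 2))"] by (simp add: field_simps)
  also have "\<dots> \<le> 9 / 16" using e by simp
  finally have "7 / 16 \<le> 1 + real (k + 1) * (- ?h)" by simp
  also have "\<dots> \<le> (1 + (- ?h)) ^ (k + 1)"
  proof (intro Bernoulli_inequality)
    have "exp 1 / 2 ^ (k + 1) = 2 * ?h" by simp
    then show "- 1 \<le> - ?h" using t1 unfolding t_def by linarith
  qed
  finally have "7 / 16 * (5 / 2) \<le> (1 - ?h) ^ (k + 1) * exp 1"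
    using e by (intro mult_mono) auto
  also have "\<dots> = t ^ (k + 1) * (2 - t)"
  proof -
    have "t = 2 * (1 - ?h)" by (simp add: t_def field_simps)
    then have "t ^ (k + 1) = 2 ^ (k + 1) * (1 - ?h) ^ (k + 1)" by (metis power_mult_distrib)
    moreover have "2 - t = exp 1 / 2 ^ (k + 1)" by (simp add: t_def)
    ultimately show ?thesis by simp
  qed
  finally have "(t - 1) * (t ^ (k + 1) - (\<Sum>i\<le>k. t ^ i)) < 0"
    unfolding char_poly_telescope by simp
  then show "t ^ (k + 1) < (\<Sum>i\<le>k. t ^ i)"
    using t1 by (simp add: mult_less_0_iff)
qed

lemma char_root_unique_exists:
  assumes "k \<ge> 2"
  shows "\<exists>!s::real. s > 0 \<and> s ^ (k + 1) = (\<Sum>i\<le>k. s ^ i)"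
proof (rule ex_ex1I)
  define t :: real where "t = 2 - exp 1 / 2 ^ (k + 1)"
  note t = char_poly_neg_at_lower_bound[OF assms, folded t_def]
  \<comment> \<open>The root is found between the lower bound, where the sign is negative, and $2$, where it is positive.\<close>
  have "(2::real) ^ (k + 1) - (\<Sum>i\<le>k. 2 ^ i) = 1"
    using char_poly_telescope[of 2 k] by simp
  then have "\<exists>s\<ge>t. s \<le> 2 \<and> s ^ (k + 1) - (\<Sum>i\<le>k. s ^ i) = 0"
    using t by (intro IVT') (auto simp: t_def intro!: continuous_intros)
  then show "\<exists>s::real. s > 0 \<and> s ^ (k + 1) = (\<Sum>i\<le>k. s ^ i)"
    using t(1) by (metis eq_iff_diff_eq_0 less_le_trans zero_less_one less_trans)
next
  fix s s' :: real
  assume "s > 0 \<and> s ^ (k + 1) = (\<Sum>i\<le>k. s ^ i)" "s' > 0 \<and> s' ^ (k + 1) = (\<Sum>i\<le>k. s' ^ i)"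
  then show "s = s'"
    using char_poly_sign_mono[of s s' k] char_poly_sign_mono[of s' s k]
    by (metis less_irrefl linorder_cases order_refl)
qed

lemma secant_order_root:
  assumes "k \<ge> 2"
  shows "secant_order k > 0" "secant_order k ^ (k + 1) = (\<Sum>i\<le>k. secant_order k ^ i)"
  using theI'[OF char_root_unique_exists[OF assms]] unfolding secant_order_def by auto

lemma less_secant_orderI:
  assumes "k \<ge> 2" "t ^ (k + 1) < (\<Sum>i\<le>k. t ^ i)"
  shows "t < secant_order k"
  using char_poly_sign_mono[of "secant_order k" t k] secant_order_root[OF assms(1)] assms(2)
  by (metis less_asym less_irrefl linorder_cases order_refl)

lemma secant_order_bounds:
  assumes "k \<ge> 2"
  shows "2 - exp 1 / 2 ^ (k + 1) < secant_order k" "1 < secant_order k"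
    "secant_order k < 2 - 1 / 2 ^ (k + 1)" "secant_order k < 2"
proof -
  let ?s = "secant_order k"
  show "2 - exp 1 / 2 ^ (k + 1) < ?s"
    using less_secant_orderI[OF assms] char_poly_neg_at_lower_bound[OF assms] by blast
  then show s1: "1 < ?s" using char_poly_neg_at_lower_bound(1)[OF assms] by linarith
  have eq: "?s ^ (k + 1) * (2 - ?s) = 1"
    using char_poly_telescope[of ?s k] secant_order_root[OF assms] by simp
  have p: "?s ^ (k + 1) > 0" using s1 by simp
  then show s2: "?s < 2" using eq by (metis diff_gt_0_iff_gt zero_less_mult_pos zero_less_one)
  have "?s ^ (k + 1) < 2 ^ (k + 1)"
    using s1 s2 by (intro power_strict_mono) auto
  then have "1 / 2 ^ (k + 1) < 1 / ?s ^ (k + 1)" using p by (intro divide_strict_left_mono) auto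
  also have "\<dots> = 2 - ?s" using eq p by (metis nonzero_eq_divide_eq mult.commute less_irrefl)
  finally show "?s < 2 - 1 / 2 ^ (k + 1)" by simp
qed

text \<open>At the root $s$ for $k$, the characteristic polynomial for $k+1$ equals $s \cdot 0 - 1 = -1$, so its root
lies further to the right.\<close>

lemma secant_order_less_Suc:
  assumes "k \<ge> 2"
  shows "secant_order k < secant_order (k + 1)"
proof (rule less_secant_orderI)
  let ?s = "secant_order k"
  have "(\<Sum>i\<le>k+1. ?s ^ i) = 1 + ?s * (\<Sum>i\<le>k. ?s ^ i)"
    by (simp add: sum.atMost_Suc_shift sum_distrib_left del: sum.atMost_Suc)
  then show "?s ^ (k + 1 + 1) < (\<Sum>i\<le>k+1. ?s ^ i)"
    using secant_order_root(2)[OF assms] by simp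
qed (use assms in auto)

lemma secant_order_tendsto: "secant_order \<longlonglongrightarrow> 2"
proof (rule tendsto_sandwich)
  show "(\<lambda>k. 2 - exp 1 / 2 ^ (k + 1) :: real) \<longlonglongrightarrow> 2"
  proof -
    have "(\<lambda>k. 2 - exp 1 / 2 * (1 / 2) ^ k :: real) \<longlonglongrightarrow> 2 - exp 1 / 2 * 0"
      by (intro tendsto_intros LIMSEQ_power_zero) auto
    then show ?thesis by (simp add: power_divide)
  qed
  show "\<forall>\<^sub>F k in sequentially. 2 - exp 1 / 2 ^ (k + 1) \<le> secant_order k"
    using secant_order_bounds(1) by (auto intro!: eventually_sequentiallyI[of 2] less_imp_le)
  show "\<forall>\<^sub>F k in sequentially. secant_order k \<le> 2"
    using secant_order_bounds(4) by (auto intro!: eventually_sequentiallyI[of 2] less_imp_le)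
qed auto

section \<open>A stable linear recurrence\<close>

lemma sum_shift_last_zero:
  fixes b :: "nat \<Rightarrow> real"
  assumes "b (Suc k) = 0"
  shows "(\<Sum>i\<le>k. b i * g i) = b 0 * g 0 + (\<Sum>i\<le>k. b (Suc i) * g (Suc i))"
  using sum.atMost_Suc_shift[of "\<lambda>i. b i * g i" k] assms by simp

text \<open>Taking differences of consecutive values of $\eta$ turns the recurrence into an averaging identity
$\sum_i d_i (e_n - e_{n-1-i}) = \eta_n - \eta_{n-1}$ with positive weights $d_i = b_i - b_{i+1}$. If
$e_n$ is almost maximal in its window, all terms on the left are bounded below, so small $\eta$ forces the whole window
to be close to $e_n$; but then $\eta_n \approx (\sum_i b_i) \, e_n$, so $e_n$ cannot be large.\<close>

lemma decreasing_recurrence_step: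
  fixes b e \<eta> :: "nat \<Rightarrow> real" and k :: nat
  defines "\<eta> \<equiv> \<lambda>n. \<Sum>i\<le>k. b i * e (n - i)"
  assumes d: "d > 0" "\<And>i. i \<le> k \<Longrightarrow> d \<le> b i - b (Suc i)" and bk: "b (Suc k) = 0"
    and n: "k < n" and \<eta>: "\<eta> n \<le> H" "\<bar>\<eta> (n - 1)\<bar> \<le> H" and tau: "\<tau> \<ge> 0"
    and le: "\<And>i. i \<le> k \<Longrightarrow> e (n - Suc i) \<le> e n + \<tau>"
  shows "(\<Sum>i\<le>k. b i) * e n \<le> H + (\<Sum>i\<le>k. b i) * ((2 * H + b 0 * \<tau>) / d)"
proof -
  let ?d = "\<lambda>i. b i - b (Suc i)" and ?K = "(2 * H + b 0 * \<tau>) / d"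
  have bnn: "b i \<ge> 0" if "i \<le> Suc k" for i
    using that
  proof (induction rule: inc_induct)
    case (step m) then show ?case using d(2)[of m] d(1) by simp
  qed (simp add: bk)
  have sd: "(\<Sum>i\<le>k. ?d i) = b 0"
    using sum_shift_last_zero[of b k "\<lambda>_. 1"] bk by (simp add: sum_subtractf)
  have "\<eta> n = b 0 * e n + (\<Sum>i\<le>k. b (Suc i) * e (n - Suc i))"
    unfolding \<eta>_def using sum_shift_last_zero[of b k "\<lambda>i. e (n - i)"] bk by simp
  also have "b 0 * e n = (\<Sum>i\<le>k. ?d i * e n)" by (simp only: sd[symmetric] sum_distrib_right)
  finally have eq: "\<eta> n - \<eta> (n - 1) = (\<Sum>i\<le>k. ?d i * (e n - e (n - Suc i)))"
    unfolding \<eta>_def by (simp add: sum.distrib sum_subtractf algebra_simps)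
  have H: "\<eta> n - \<eta> (n - 1) \<le> 2 * H" using \<eta> by linarith
  have KH: "H \<ge> 0" using \<eta> by linarith
  have b0: "b 0 \<ge> 0" using bnn by simp
  have close: "e n - e (n - Suc j) \<le> ?K" if j: "j \<le> k" for j
  proof -
    have "?d j * (e n - e (n - Suc j) + \<tau>) \<le> (\<Sum>i\<le>k. ?d i * (e n - e (n - Suc i) + \<tau>))"
    proof (rule member_le_sum)
      fix i assume "i \<in> {..k} - {j}"
      then show "0 \<le> ?d i * (e n - e (n - Suc i) + \<tau>)"
        using le[of i] d(1) d(2)[of i] by (intro mult_nonneg_nonneg) auto
    qed (use j in auto)
    also have "\<dots> = \<eta> n - \<eta> (n - 1) + b 0 * \<tau>"
      by (simp only: eq sd[symmetric] sum_distrib_right sum.distrib[symmetric] distrib_left)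
    also have "\<dots> \<le> 2 * H + b 0 * \<tau>" using H by simp
    finally have *: "?d j * (e n - e (n - Suc j) + \<tau>) \<le> 2 * H + b 0 * \<tau>" .
    have "d * (e n - e (n - Suc j) + \<tau>) \<le> ?d j * (e n - e (n - Suc j) + \<tau>)"
      using d(2)[OF j] le[OF j] by (intro mult_right_mono) auto
    with * have "e n - e (n - Suc j) + \<tau> \<le> ?K"
      using d(1) by (simp add: pos_le_divide_eq mult.commute)
    then show ?thesis using tau by simp
  qed
  have "(\<Sum>i\<le>k. b i) * (e n - ?K) \<le> \<eta> n"
    unfolding \<eta>_def sum_distrib_right
  proof (rule sum_mono)
    fix i assume i: "i \<in> {..k}"
    have "e n - ?K \<le> e (n - i)"
    proof (cases i)
      case 0
      then show ?thesis using KH b0 tau d(1) by simp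
    next
      case (Suc j) then show ?thesis using close[of j] i by simp
    qed
    then show "b i * (e n - ?K) \<le> b i * e (n - i)" using bnn[of i] i by (intro mult_left_mono) auto
  qed
  then show ?thesis using \<eta>(1) by (simp add: algebra_simps)
qed

text \<open>The two-sided form, with one constant for all sequences. With $\tau = 0$ it controls record values and
hence gives boundedness; with small $\tau$ it shows that the supremum of the tail contracts.\<close>

lemma decreasing_recurrence_bound:
  fixes b :: "nat \<Rightarrow> real"
  assumes dec: "\<forall>i\<le>k. b (Suc i) < b i" and bk: "b (Suc k) = 0"
  shows "\<exists>A\<ge>1. \<forall>e n H \<tau>. k < n \<and> \<bar>\<Sum>i\<le>k. b i * e (n - i)\<bar> \<le> H \<and>
      \<bar>\<Sum>i\<le>k. b i * e (n - 1 - i)\<bar> \<le> H \<and> \<tau> \<ge> 0 \<and>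
      (\<forall>i\<le>k. \<bar>e (n - Suc i)\<bar> \<le> \<bar>e n\<bar> + \<tau>) \<longrightarrow> \<bar>e n\<bar> \<le> A * (H + \<tau>)"
proof -
  define d where "d = Min ((\<lambda>i. b i - b (Suc i)) ` {..k})"
  have d: "d > 0" "\<And>i. i \<le> k \<Longrightarrow> d \<le> b i - b (Suc i)"
    using dec unfolding d_def by (subst Min_gr_iff, auto)
  have bpos: "b i > 0" if "i \<le> k" for i
    using that
  proof (induction rule: inc_induct)
    case base then show ?case using dec[rule_format, of k] bk by simp
  next
    case (step m) then show ?case using dec[rule_format, of m] by simp
  qed
  define B where "B = (\<Sum>i\<le>k. b i)"
  have B: "B > 0" unfolding B_def using bpos by (intro sum_pos) auto
  define A where "A = 1 + (1 / B + 2 / d + b 0 / d)"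
  have A: "A \<ge> 1" unfolding A_def using B d(1) bpos[of 0] by simp
  have one: "e n \<le> A * (H + \<tau>)"
    if n: "k < n" and h: "\<bar>\<Sum>i\<le>k. b i * e (n - i)\<bar> \<le> H" "\<bar>\<Sum>i\<le>k. b i * e (n - 1 - i)\<bar> \<le> H"
      and t: "\<tau> \<ge> 0" and le: "\<And>i. i \<le> k \<Longrightarrow> e (n - Suc i) \<le> e n + \<tau>" for e n H \<tau>
  proof -
    have "B * e n \<le> H + B * ((2 * H + b 0 * \<tau>) / d)"
      unfolding B_def by (rule decreasing_recurrence_step[OF d bk n _ _ t le]) (use h in auto)
    then have "e n \<le> H / B + (2 * H + b 0 * \<tau>) / d"
      using B by (simp add: field_simps)
    also have "\<dots> \<le> A * (H + \<tau>)"
    proof -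
      have "A * (H + \<tau>) - (H / B + (2 * H + b 0 * \<tau>) / d) =
          (H + \<tau>) + \<tau> / B + 2 * \<tau> / d + b 0 * H / d"
        by (simp add: A_def algebra_simps add_divide_distrib)
      moreover have "\<dots> \<ge> 0" using B d(1) bpos[of 0] t h by (intro add_nonneg_nonneg) auto
      ultimately show ?thesis by linarith
    qed
    finally show ?thesis .
  qed
  show ?thesis
  proof (intro exI[of _ A] conjI allI impI A; elim conjE)
    fix e :: "nat \<Rightarrow> real" and n H \<tau>
    assume *: "k < n" "\<bar>\<Sum>i\<le>k. b i * e (n - i)\<bar> \<le> H" "\<bar>\<Sum>i\<le>k. b i * e (n - 1 - i)\<bar> \<le> H"
      "\<tau> \<ge> 0" and win: "\<forall>i\<le>k. \<bar>e (n - Suc i)\<bar> \<le> \<bar>e n\<bar> + \<tau>"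
    show "\<bar>e n\<bar> \<le> A * (H + \<tau>)"
    proof (cases "e n \<ge> 0")
      case True
      have "e n \<le> A * (H + \<tau>)"
      proof (rule one[OF *(1-4)])
        show "e (n - Suc i) \<le> e n + \<tau>" if "i \<le> k" for i using win[rule_format, OF that] True by linarith
      qed
      then show ?thesis using True by simp
    next
      case False
      have "- e n \<le> A * (H + \<tau>)"
      proof (rule one[of n "\<lambda>i. - e i", OF *(1) _ _ *(4)])
        show "- e (n - Suc i) \<le> - e n + \<tau>" if "i \<le> k" for i using win[rule_format, OF that] False by linarith
      qed (use *(2,3) in \<open>simp_all add: sum_negf\<close>)
      then show ?thesis using False by simp
    qed
  qed
qed

text \<open>The analytic counterpart of the Enestrom--Kakeya theorem: since the coefficients decrease strictly to
$b_{k+1} = 0$, the recurrence is stable. The argument avoids complex roots. The sequence is bounded, and any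
eventual bound $K$ improves to $\theta K$ with a fixed $\theta < 1$: an index violating this would have
$|e_n| > \theta K = K - \tau$, so it would be within $\tau$ of the maximum of its window, and
the previous bound would give $|e_n| \leq K/2$.\<close>

lemma decreasing_recurrence_tendsto_0:
  fixes b e :: "nat \<Rightarrow> real"
  assumes dec: "\<forall>i\<le>k. b (Suc i) < b i" and bk: "b (Suc k) = 0"
    and lim: "(\<lambda>n. \<Sum>i\<le>k. b i * e (n - i)) \<longlonglongrightarrow> 0"
  shows "e \<longlonglongrightarrow> 0"
proof -
  define \<eta> where "\<eta> = (\<lambda>n. \<Sum>i\<le>k. b i * e (n - i))"
  obtain A where A: "A \<ge> 1" and bd: "\<forall>e n H \<tau>. k < n \<and> \<bar>\<Sum>i\<le>k. b i * e (n - i)\<bar> \<le> H \<and>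
      \<bar>\<Sum>i\<le>k. b i * e (n - 1 - i)\<bar> \<le> H \<and> \<tau> \<ge> 0 \<and>
      (\<forall>i\<le>k. \<bar>e (n - Suc i)\<bar> \<le> \<bar>e n\<bar> + \<tau>) \<longrightarrow> \<bar>e n\<bar> \<le> A * (H + \<tau>)"
    using decreasing_recurrence_bound[of k b, OF dec bk]
    by (elim exE conjE) (rule that)
  have bound: "\<bar>e n\<bar> \<le> A * (H + \<tau>)"
    if "k < n" "\<bar>\<eta> n\<bar> \<le> H" "\<bar>\<eta> (n - 1)\<bar> \<le> H" "\<tau> \<ge> 0"
      "\<And>i. i \<le> k \<Longrightarrow> \<bar>e (n - Suc i)\<bar> \<le> \<bar>e n\<bar> + \<tau>" for n H \<tau>
    using that by (intro bd[rule_format]) (auto simp: \<eta>_def)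
  have lim': "\<eta> \<longlonglongrightarrow> 0" using lim by (simp add: \<eta>_def)
  then have "Bseq \<eta>" by (intro convergent_imp_Bseq) (auto simp: convergent_def)
  then obtain H where H: "H > 0" "\<And>n. \<bar>\<eta> n\<bar> \<le> H" by (auto simp: Bseq_def)
  define M where "M = A * H + (\<Sum>j\<le>k. \<bar>e j\<bar>)"
  have M: "M > 0" unfolding M_def using A H(1) by (intro add_pos_nonneg) auto
  have eM: "\<bar>e n\<bar> \<le> M" for n
  proof (induction n rule: less_induct)
    case (less n)
    show ?case
    proof (cases "k < n")
      case False
      then have "\<bar>e n\<bar> \<le> (\<Sum>j\<le>k. \<bar>e j\<bar>)" by (intro member_le_sum) auto
      then show ?thesis unfolding M_def using A H(1) by (simp add: add_increasing)
    next
      case True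
      show ?thesis
      proof (rule ccontr)
        assume c: "\<not> \<bar>e n\<bar> \<le> M"
        have "\<bar>e n\<bar> \<le> A * (H + 0)"
        proof (rule bound[OF True H(2) H(2)])
          fix i show "\<bar>e (n - Suc i)\<bar> \<le> \<bar>e n\<bar> + 0"
            using less[of "n - Suc i"] True c by simp
        qed simp
        also have "\<dots> \<le> M" unfolding M_def by (simp add: sum_nonneg)
        finally show False using c by simp
      qed
    qed
  qed
  define \<theta> where "\<theta> = 1 - 1 / (4 * A)"
  have \<theta>: "1 / 2 \<le> \<theta>" "\<theta> < 1" unfolding \<theta>_def using A by (auto simp: field_simps)
  have contr: "eventually (\<lambda>n. \<bar>e n\<bar> \<le> \<theta> * K) sequentially"
    if K: "K > 0" and ev: "eventually (\<lambda>n. \<bar>e n\<bar> \<le> K) sequentially" for K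
  proof -
    \<comment> \<open>The choice makes both $A \cdot 2\tau = K/2$ and $K - \tau = \theta K$.\<close>
    define \<tau> where "\<tau> = K / (4 * A)"
    have t: "\<tau> > 0" unfolding \<tau>_def using K A by simp
    obtain N1 where N1: "\<And>n. n \<ge> N1 \<Longrightarrow> \<bar>e n\<bar> \<le> K" using ev by (auto simp: eventually_sequentially)
    obtain N2 where N2: "\<And>n. n \<ge> N2 \<Longrightarrow> \<bar>\<eta> n\<bar> < \<tau>"
      using LIMSEQ_D[OF lim' t] by auto
    have "\<bar>e n\<bar> \<le> \<theta> * K" if n: "n \<ge> N1 + N2 + k + 1" for n
    proof (rule ccontr)
      assume c: "\<not> \<bar>e n\<bar> \<le> \<theta> * K"
      have "\<bar>e n\<bar> \<le> A * (\<tau> + \<tau>)"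
      proof (rule bound)
        fix i assume "i \<le> k"
        then have "\<bar>e (n - Suc i)\<bar> \<le> K" using N1[of "n - Suc i"] n by simp
        also have "K = \<theta> * K + \<tau>" by (simp add: \<theta>_def \<tau>_def algebra_simps)
        finally show "\<bar>e (n - Suc i)\<bar> \<le> \<bar>e n\<bar> + \<tau>" using c by simp
            next
        have "N2 \<le> n - 1" "N2 \<le> n" using n by auto
        then show "\<bar>\<eta> (n - 1)\<bar> \<le> \<tau>" "\<bar>\<eta> n\<bar> \<le> \<tau>" using N2 less_imp_le by blast+
      qed (use t n in auto)
      also have "\<dots> = 1 / 2 * K" unfolding \<tau>_def using A by simp
      also have "\<dots> \<le> \<theta> * K" using K \<theta> by (intro mult_right_mono) auto
      finally show False using c by simp
    qed
    then show ?thesis by (auto simp: eventually_sequentially)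
  qed
  have iter: "eventually (\<lambda>n. \<bar>e n\<bar> \<le> \<theta> ^ j * M) sequentially" for j
  proof (induction j)
    case (Suc j)
    then show ?case using contr[of "\<theta> ^ j * M"] \<theta> M by (simp add: mult.assoc)
  qed (simp add: eM)
  show ?thesis
  proof (rule LIMSEQ_I)
    fix r :: real assume r: "r > 0"
    have "(\<lambda>j. \<theta> ^ j * M) \<longlonglongrightarrow> 0 * M"
      using \<theta> by (intro tendsto_intros LIMSEQ_power_zero) auto
    then have "eventually (\<lambda>j. \<theta> ^ j * M < r) sequentially"
      using r by (intro order_tendstoD) auto
    then obtain j where "\<theta> ^ j * M < r" by (auto simp: eventually_sequentially)
    then have "eventually (\<lambda>n. \<bar>e n\<bar> < r) sequentially"
      using iter[of j] by (auto elim: eventually_mono)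
    then show "\<exists>no. \<forall>n\<ge>no. norm (e n - 0) < r" by (auto simp: eventually_sequentially)
  qed
qed

text \<open>The passage from the limit of $\epsilon_{n+1}/\prod_{i=0}^k \epsilon_{n-i}$ to the order. The $b_i$ are the
coefficients of the quotient of $z^{k+1} - \sum_{i=0}^k z^i$ by $z - s$, computed by Horner's scheme; their
differences $(2-s) s^i$ are positive precisely because $s < 2$.\<close>

lemma order_from_product_recurrence:
  fixes \<epsilon> :: "nat \<Rightarrow> real" and s L :: real
  assumes k: "k \<ge> 1" and s: "1 < s" "s < 2" "s ^ (k + 1) = (\<Sum>i\<le>k. s ^ i)"
    and nz: "\<And>n. n \<ge> N \<Longrightarrow> \<epsilon> n \<noteq> 0" and L: "L \<noteq> 0"
    and lim: "(\<lambda>n. \<epsilon> (Suc n) / (\<Prod>i\<le>k. \<epsilon> (n - i))) \<longlonglongrightarrow> L"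
  shows "(\<lambda>n. \<bar>\<epsilon> (Suc n)\<bar> / \<bar>\<epsilon> n\<bar> powr s) \<longlonglongrightarrow> \<bar>L\<bar> powr ((s - 1) / real k)"
proof -
  define b where "b = rec_nat 1 (\<lambda>_ y. s * y - 1)"
  have b0: "b 0 = 1" and bS: "b (Suc i) = s * b i - 1" for i by (simp_all add: b_def)
  have beq: "b (Suc i) = s ^ (i + 1) - (\<Sum>j\<le>i. s ^ j)" for i
  proof (induction i)
    case (Suc i)
    have "(\<Sum>j\<le>Suc i. s ^ j) = 1 + s * (\<Sum>j\<le>i. s ^ j)"
      by (simp add: sum.atMost_Suc_shift sum_distrib_left del: sum.atMost_Suc)
    then show ?case unfolding bS[of "Suc i"] Suc.IH by (simp add: algebra_simps del: sum.atMost_Suc)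
  qed (simp add: bS b0)
  \<comment> \<open>The remainder of the division vanishes because \<open>s\<close> is a root.\<close>
  have bk: "b (Suc k) = 0" using beq[of k] s(3) by simp
  have diff: "b i - b (Suc i) = (2 - s) * s ^ i" for i
  proof (induction i)
    case (Suc i)
    have "b (Suc i) - b (Suc (Suc i)) = s * (b i - b (Suc i))"
      by (simp add: bS algebra_simps)
    then show ?case using Suc by simp
  qed (simp add: b0 bS)
  have dec: "b (Suc i) < b i" for i
  proof -
    have "0 < (2 - s) * s ^ i" using s(1,2) by simp
    then show ?thesis using diff[of i] by linarith
  qed
  define B where "B = (\<Sum>i\<le>k. b i)"
  have "B = 1 + (\<Sum>i\<le>k. b (Suc i))"
    using sum_shift_last_zero[of b k "\<lambda>_. 1"] bk b0 by (simp add: B_def)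
  also have "(\<Sum>i\<le>k. b (Suc i)) = s * B - (real k + 1)"
    by (simp add: bS sum_subtractf sum_distrib_left B_def)
  \<comment> \<open>Summing the recursion for \<open>b\<close> yields the exponent of the limit.\<close>
  finally have Bs: "B * (s - 1) = real k" by (simp add: algebra_simps)
  then have B: "B = real k / (s - 1)" "B \<noteq> 0" using s(1) k by (auto simp: field_simps)

  define u where "u = (\<lambda>n. ln \<bar>\<epsilon> n\<bar>)"
  define v where "v = (\<lambda>n. u (Suc n) - s * u n)"
  have key: "(\<Sum>i\<le>k. b i * v (n - i)) = u (Suc n) - (\<Sum>i\<le>k. u (n - i))" if "n \<ge> k" for n
  proof -
    have "(\<Sum>i\<le>k. b i * v (n - i)) = (\<Sum>i\<le>k. b i * u (Suc n - i)) - (\<Sum>i\<le>k. s * b i * u (n - i))"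
      unfolding sum_subtractf[symmetric]
      by (rule sum.cong) (use that in \<open>auto simp: v_def algebra_simps Suc_diff_le\<close>)
    also have "(\<Sum>i\<le>k. b i * u (Suc n - i)) = u (Suc n) + (\<Sum>i\<le>k. b (Suc i) * u (n - i))"
      using sum_shift_last_zero[of b k "\<lambda>i. u (Suc n - i)"] bk b0 by simp
    finally show ?thesis
      by (simp add: bS algebra_simps sum_subtractf)
  qed
  have lnlim: "(\<lambda>n. ln \<bar>\<epsilon> (Suc n) / (\<Prod>i\<le>k. \<epsilon> (n - i))\<bar>) \<longlonglongrightarrow> ln \<bar>L\<bar>"
    using L by (intro tendsto_ln tendsto_rabs lim) auto
  have "(\<lambda>n. \<Sum>i\<le>k. b i * v (n - i)) \<longlonglongrightarrow> ln \<bar>L\<bar>"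
  proof (rule Lim_transform_eventually[OF lnlim])
    have "ln \<bar>\<epsilon> (Suc n) / (\<Prod>i\<le>k. \<epsilon> (n - i))\<bar> = (\<Sum>i\<le>k. b i * v (n - i))" if n: "n \<ge> N + k" for n
    proof -
      have nzi: "\<epsilon> (n - i) \<noteq> 0" if "i \<le> k" for i using n that by (intro nz) simp
      have "ln \<bar>\<epsilon> (Suc n) / (\<Prod>i\<le>k. \<epsilon> (n - i))\<bar> = ln \<bar>\<epsilon> (Suc n)\<bar> - ln (\<Prod>i\<le>k. \<bar>\<epsilon> (n - i)\<bar>)"
        unfolding abs_divide abs_prod using nzi nz[of "Suc n"] n
        by (intro ln_divide_pos) (auto intro!: prod_pos)
      also have "ln (\<Prod>i\<le>k. \<bar>\<epsilon> (n - i)\<bar>) = (\<Sum>i\<le>k. u (n - i))"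
        unfolding u_def using nzi by (intro ln_prod) auto
      finally show ?thesis using key[of n] n by (simp add: u_def)
    qed
    then show "\<forall>\<^sub>F n in sequentially. ln \<bar>\<epsilon> (Suc n) / (\<Prod>i\<le>k. \<epsilon> (n - i))\<bar> = (\<Sum>i\<le>k. b i * v (n - i))"
      by (auto simp: eventually_sequentially)
  qed
  then have "(\<lambda>n. (\<Sum>i\<le>k. b i * v (n - i)) - ln \<bar>L\<bar>) \<longlonglongrightarrow> 0" by (simp add: LIM_zero)
  moreover have "(\<Sum>i\<le>k. b i * v (n - i)) - ln \<bar>L\<bar> = (\<Sum>i\<le>k. b i * (v (n - i) - ln \<bar>L\<bar> / B))" for n
    using B(2) by (simp add: right_diff_distrib sum_subtractf sum_divide_distrib[symmetric]
        sum_distrib_right[symmetric] B_def[symmetric])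
  ultimately have "(\<lambda>n. v n - ln \<bar>L\<bar> / B) \<longlonglongrightarrow> 0"
    using decreasing_recurrence_tendsto_0[of k b "\<lambda>n. v n - ln \<bar>L\<bar> / B"] dec bk by simp
  then have "v \<longlonglongrightarrow> ln \<bar>L\<bar> / B" by (rule LIM_zero_cancel)
  then have "(\<lambda>n. exp (v n)) \<longlonglongrightarrow> exp (ln \<bar>L\<bar> / B)" by (rule tendsto_exp)
  moreover have "exp (ln \<bar>L\<bar> / B) = \<bar>L\<bar> powr ((s - 1) / real k)"
    using L by (simp add: B(1) powr_def)
  moreover have "exp (v n) = \<bar>\<epsilon> (Suc n)\<bar> / \<bar>\<epsilon> n\<bar> powr s" if "n \<ge> N" for n
    using nz[of n] nz[of "Suc n"] that by (simp add: v_def u_def exp_diff powr_def)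
  then have "\<forall>\<^sub>F n in sequentially. exp (v n) = \<bar>\<epsilon> (Suc n)\<bar> / \<bar>\<epsilon> n\<bar> powr s"
    by (auto simp: eventually_sequentially)
  ultimately show ?thesis by (simp add: Lim_transform_eventually)
qed

section \<open>Derivative of the interpolation error\<close>

lemma Ck_on_DERIV:
  assumes "Ck_on m f S" "j < m" "t \<in> S"
  shows "((deriv ^^ j) f has_real_derivative (deriv ^^ Suc j) f t) (at t)"
  using assms by (auto simp: Ck_on_def DERIV_deriv_iff_real_differentiable)

lemma Ck_on_isCont:
  assumes "Ck_on m f S" "open S" "j \<le> m" "t \<in> S"
  shows "isCont ((deriv ^^ j) f) t"
proof (cases "j = m")
  case True
  then show ?thesis
    using assms by (auto simp: Ck_on_def continuous_on_eq_continuous_at)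
next
  case False
  then show ?thesis using Ck_on_DERIV[OF assms(1) _ assms(4), of j] assms(3)
    by (auto intro: DERIV_isCont)
qed

text \<open>One Rolle point lies in each gap between consecutive zeros. That these points avoid the zeros of \<open>g\<close>
matters below, where a further zero of \<open>g'\<close> at an old node has to be counted as a new one; the bound by an
element of \<open>Z\<close> keeps the points apart in the induction, which adds zeros from left to right.\<close>

lemma Rolle_finite_zeros:
  fixes g g' :: "real \<Rightarrow> real"
  assumes "finite Z" "Z \<subseteq> S" "is_interval S"
    and "\<And>t. t \<in> S \<Longrightarrow> (g has_real_derivative g' t) (at t)"
    and "\<And>z. z \<in> Z \<Longrightarrow> g z = 0"
  shows "\<exists>Z'\<subseteq>S. finite Z' \<and> card Z' = card Z - 1 \<and> Z' \<inter> Z = {} \<and> (\<forall>z\<in>Z'. g' z = 0 \<and> (\<exists>y\<in>Z. z < y))"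
  using assms(1,2,5)
proof (induction Z rule: finite_linorder_max_induct)
  case empty
  then show ?case by auto
next
  case (insert b A)
  show ?case
  proof (cases "A = {}")
    case True
    then show ?thesis by (intro exI[of _ "{}"]) auto
  next
    case False
    define a where "a = Max A"
    have a: "a \<in> A" "\<And>z. z \<in> A \<Longrightarrow> z \<le> a" "a < b"
      using insert False by (auto simp: a_def)
    have ab: "t \<in> S" if "a \<le> t" "t \<le> b" for t
      using assms(3) that insert.prems a by (auto simp: is_interval_1)
    have D: "(g has_real_derivative g' t) (at t)" if "a \<le> t" "t \<le> b" for t
      using assms(4) ab that by blast
    obtain c where c: "a < c" "c < b" "(g has_real_derivative 0) (at c)"
    proof -
      have "continuous_on {a..b} g"
        using D by (intro continuous_at_imp_continuous_on ballI) (meson DERIV_isCont atLeastAtMost_iff)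
      moreover have "g differentiable (at t)" if "a < t" "t < b" for t
        using D[of t] that by (auto simp: real_differentiable_def)
      ultimately show ?thesis
        using Rolle[of a b g] a insert.prems that by fastforce
    qed
    have g'c: "g' c = 0" using DERIV_unique[OF c(3) D] c by auto
    obtain Z' where Z': "Z' \<subseteq> S" "finite Z'" "card Z' = card A - 1" "Z' \<inter> A = {}"
      "\<And>z. z \<in> Z' \<Longrightarrow> g' z = 0" "\<And>z. z \<in> Z' \<Longrightarrow> \<exists>y\<in>A. z < y"
      using insert.IH insert.prems by auto
    have lt: "z < a" if "z \<in> Z'" for z using Z'(6)[OF that] a(2) by fastforce
    have "c \<notin> Z'" using lt c(1) by force
    moreover have "b \<notin> Z'" using lt a(3) by force
    moreover have "b \<notin> A" "c \<notin> A" using insert.hyps a(2) c(1) by force+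
    moreover have "card A > 0" using False insert.hyps by (simp add: card_gt_0_iff)
    ultimately show ?thesis
      using Z' g'c c ab[of c] insert.hyps
      by (intro exI[of _ "insert c Z'"]) (auto intro: less_imp_le)
  qed
qed

lemma Rolle_iterated:
  fixes G :: "nat \<Rightarrow> real \<Rightarrow> real"
  assumes "is_interval S"
    and "\<And>j t. j < m \<Longrightarrow> t \<in> S \<Longrightarrow> (G j has_real_derivative G (Suc j) t) (at t)"
    and "finite Z" "Z \<subseteq> S" "card Z = Suc m" "\<And>z. z \<in> Z \<Longrightarrow> G 0 z = 0"
  shows "\<exists>\<xi>\<in>S. G m \<xi> = 0"
  using assms(2-)
proof (induction m arbitrary: G Z)
  case 0
  then show ?case by (metis One_nat_def card_1_singletonE insert_subset singletonI)
next
  case (Suc m)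
  obtain Z' where "Z' \<subseteq> S" "finite Z'" "card Z' = Suc m" "\<forall>z\<in>Z'. G 1 z = 0"
    using Rolle_finite_zeros[OF Suc.prems(2,3) assms(1), of "G 0" "G 1"] Suc.prems by auto
  then show ?case using Suc.IH[of "\<lambda>j. G (Suc j)" Z'] Suc.prems(1) by auto
qed

lemma higher_pderiv_degree:
  fixes q :: "real poly"
  assumes "degree q \<le> m"
  shows "poly ((pderiv ^^ m) q) t = fact m * coeff q m"
proof -
  have "(pderiv ^^ m) q = [:fact m * coeff q m:]"
    using assms by (intro poly_eqI)
      (auto simp: coeff_higher_pderiv pochhammer_fact coeff_pCons coeff_eq_0 split: nat.splits)
  then show ?thesis by simp
qed

text \<open>The idea is that of the usual remainder formula, but for the derivative at a node: with $W = \prod_{z \in N} (X - z)$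
choose $K$ such that $G = f - p - K W$ has $G'(y) = 0$. Besides the Rolle points in the $k$ gaps, $G'$ then has the zero
$y$, thus $k+1$ zeros in total, and $G^{(k+1)} = f^{(k+1)} - K (k+1)!$ vanishes somewhere.\<close>

lemma interpolation_deriv_error:
  fixes f :: "real \<Rightarrow> real"
  assumes C: "Ck_on (k + 1) f S" and S: "is_interval S" and N: "N \<subseteq> S" "card N = Suc k" and k: "k \<ge> 1"
    and p: "degree p \<le> k" "\<And>z. z \<in> N \<Longrightarrow> poly p z = f z" and y: "y \<in> N"
  shows "\<exists>\<xi>\<in>S. deriv f y - poly (pderiv p) y =
           (deriv ^^ (k + 1)) f \<xi> / fact (k + 1) * (\<Prod>z\<in>N - {y}. y - z)"
proof -
  have fin: "finite N" using N(2) by (intro card_ge_0_finite) simp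
  define V where "V = (\<Prod>z\<in>N - {y}. [:- z, 1:])"
  define W where "W = [:- y, 1:] * V"
  have Vy: "poly V y = (\<Prod>z\<in>N - {y}. y - z)" by (simp add: V_def poly_prod)
  have Vnz: "poly V y \<noteq> 0" using fin by (simp add: Vy)
  have W0: "poly W z = 0" if "z \<in> N" for z
    using that fin by (auto simp: W_def V_def poly_prod)
  have W': "poly (pderiv W) y = poly V y" by (simp add: W_def pderiv_mult pderiv_pCons del: mult_pCons_left)
  have WN: "W = (\<Prod>z\<in>N. [:- z, 1:])"
    using prod.remove[OF fin y, of "\<lambda>z. [:- z, 1:]"] by (simp only: W_def V_def)
  have deg: "degree W = k + 1"
    unfolding WN using N(2) by (subst degree_prod_eq_sum_degree) auto
  have "lead_coeff W = 1" unfolding WN by (simp add: lead_coeff_prod)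
  with deg have degW: "degree W \<le> k + 1" "coeff W (k + 1) = 1" by auto
  define K where "K = (deriv f y - poly (pderiv p) y) / poly V y"
  define q where "q = p + smult K W"
  have qdeg: "degree q \<le> k + 1"
    unfolding q_def using p(1) degW(1) by (intro degree_add_le) (auto intro: le_trans[OF degree_smult_le])
  have qc: "coeff q (k + 1) = K"
    using p(1) degW(2) by (simp add: q_def coeff_eq_0)
  define G where "G = (\<lambda>j t. (deriv ^^ j) f t - poly ((pderiv ^^ j) q) t)"
  have DG: "(G j has_real_derivative G (Suc j) t) (at t)" if "j < k + 1" "t \<in> S" for j t
    unfolding G_def using Ck_on_DERIV[OF C that] poly_DERIV[of "(pderiv ^^ j) q" t]
    by (auto intro!: DERIV_diff)
  obtain Z where Z: "Z \<subseteq> S" "finite Z" "card Z = k" "Z \<inter> N = {}" "\<forall>z\<in>Z. G 1 z = 0"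
    using Rolle_finite_zeros[OF fin N(1) S, of "G 0" "G 1"] DG[of 0] N(2) p(2) W0
    by (auto simp: G_def q_def)
  have "G 1 y = 0"
    using Vnz by (simp add: G_def q_def pderiv_add pderiv_smult W' K_def)
  then have "\<exists>\<xi>\<in>S. G (Suc k) \<xi> = 0"
  proof (intro Rolle_iterated[OF S, of k "\<lambda>j. G (Suc j)" "insert y Z"])
    show "card (insert y Z) = Suc k" using Z y by (subst card_insert_disjoint) auto
    show "G (Suc 0) z = 0" if "z \<in> insert y Z" for z using that Z(5) \<open>G 1 y = 0\<close> by auto
    show "(G (Suc j) has_real_derivative G (Suc (Suc j)) t) (at t)" if "j < k" "t \<in> S" for j t
      using DG[of "Suc j" t] that by simp
  qed (use Z y N(1) in auto)
  then obtain \<xi> where \<xi>: "\<xi> \<in> S" "G (k + 1) \<xi> = 0" by auto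
  then have "(deriv ^^ (k + 1)) f \<xi> = fact (k + 1) * K"
    using higher_pderiv_degree[OF qdeg, of \<xi>] by (simp only: G_def qc)
  then have "deriv f y - poly (pderiv p) y = (deriv ^^ (k + 1)) f \<xi> / fact (k + 1) * poly V y"
    using Vnz by (simp add: K_def del: fact_Suc funpow.simps)
  then show ?thesis using \<xi>(1) Vy by auto
qed

lemma Taylor_quadratic_at_root:
  fixes f :: "real \<Rightarrow> real"
  assumes C: "Ck_on m f S" "m \<ge> 2" and S: "is_interval S" and "\<alpha> \<in> S" "y \<in> S" "f \<alpha> = 0"
  shows "\<exists>\<zeta>\<in>S. (y - \<alpha>) * deriv f y - f y = (deriv ^^ 2) f \<zeta> / 2 * (y - \<alpha>) ^ 2"
proof (cases "y = \<alpha>")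
  case True
  then show ?thesis using assms by auto
next
  case False
  have "t \<in> S" if "min \<alpha> y \<le> t" "t \<le> max \<alpha> y" for t
    by (rule mem_is_interval_1_I[OF S _ _ that]) (use assms(4,5) in \<open>auto simp: min_def max_def\<close>)
  note inS = this
  have D: "\<forall>j t. j < 2 \<and> min \<alpha> y \<le> t \<and> t \<le> max \<alpha> y \<longrightarrow>
      DERIV ((deriv ^^ j) f) t :> (deriv ^^ Suc j) f t"
    using Ck_on_DERIV[OF C(1)] C(2) inS by (meson less_le_trans)
  have "\<exists>t. (if \<alpha> < y then \<alpha> < t \<and> t < y else y < t \<and> t < \<alpha>) \<and>
      f \<alpha> = (\<Sum>m<2. ((deriv ^^ m) f y / fact m) * (\<alpha> - y)^m) + ((deriv ^^ 2) f t / fact 2) * (\<alpha> - y)^2"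
    by (rule Taylor[where diff = "\<lambda>j. (deriv ^^ j) f", OF _ _ D]) (use False in auto)
  then obtain t where t: "if \<alpha> < y then \<alpha> < t \<and> t < y else y < t \<and> t < \<alpha>"
    "f \<alpha> = (\<Sum>m<2. ((deriv ^^ m) f y / fact m) * (\<alpha> - y)^m) + ((deriv ^^ 2) f t / fact 2) * (\<alpha> - y)^2"
    by (elim exE conjE) (rule that)
  have "t \<in> S" by (rule inS) (use t(1) in \<open>auto split: if_splits\<close>)
  have "f \<alpha> = f y + deriv f y * (\<alpha> - y) + (deriv ^^ 2) f t / 2 * (\<alpha> - y)^2"
    using t(2) by (simp add: lessThan_nat_numeral lessThan_Suc numeral_2_eq_2)
  moreover have "(\<alpha> - y)^2 = (y - \<alpha>)^2" by (rule power2_commute)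
  ultimately have "(y - \<alpha>) * deriv f y - f y = (deriv ^^ 2) f t / 2 * (y - \<alpha>)^2"
    using assms(6) by (simp add: algebra_simps)
  with \<open>t \<in> S\<close> show ?thesis by blast
qed

section \<open>The error recursion and local convergence\<close>

text \<open>The two remainder formulas for one step, with a common interval \<open>S\<close> for both intermediate points. As
\<open>S\<close> may be any interval containing the nodes and the root, the points inherit every bound that holds for the nodes.\<close>

lemma secant_step_error:
  fixes f :: "real \<Rightarrow> real" and x :: "nat \<Rightarrow> real"
  assumes k: "k \<ge> 1" and C: "Ck_on (k + 1) f S" and S: "is_interval S" "\<alpha> \<in> S" and root: "f \<alpha> = 0"
    and n: "k \<le> n" and nodes: "\<And>i. i \<le> k \<Longrightarrow> x (n - i) \<in> S" "inj_on x {n-k..n}"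
  obtains \<xi> \<zeta> where "\<xi> \<in> S" "\<zeta> \<in> S"
    "poly (pderiv (interp_poly f x n k)) (x n) =
       deriv f (x n) - (deriv ^^ (k + 1)) f \<xi> / fact (k + 1) * (\<Prod>i=1..k. x n - x (n - i))"
    "(x n - \<alpha>) * deriv f (x n) - f (x n) = (deriv ^^ 2) f \<zeta> / 2 * (x n - \<alpha>) ^ 2"
proof -
  define p where "p = interp_poly f x n k"
  have p: "degree p \<le> k" "\<forall>i\<in>{n-k..n}. poly p (x i) = f (x i)"
    using theI'[OF interp_poly_ex1[OF n nodes(2), of f]] unfolding p_def interp_poly_def by auto
  have bij: "bij_betw (\<lambda>i. n - i) {1..k} ({n-k..n} - {n})"
    by (rule bij_betwI[of _ _ _ "\<lambda>i. n - i"]) (use n in auto)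
  have img: "x ` {n-k..n} - {x n} = x ` ({n-k..n} - {n})"
    using inj_on_image_set_diff[OF nodes(2), of "{n-k..n}" "{n}"] by simp
  have "(\<Prod>z\<in>x ` {n-k..n} - {x n}. x n - z) = (\<Prod>j\<in>{n-k..n} - {n}. x n - x j)"
    unfolding img using nodes(2) by (subst prod.reindex) (auto intro: inj_on_subset)
  also have "\<dots> = (\<Prod>i=1..k. x n - x (n - i))"
    using prod.reindex_bij_betw[OF bij, of "\<lambda>j. x n - x j"] by simp
  finally have prod: "(\<Prod>z\<in>x ` {n-k..n} - {x n}. x n - z) = (\<Prod>i=1..k. x n - x (n - i))" .
  have "x j \<in> S" if "j \<in> {n-k..n}" for j using nodes(1)[of "n - j"] that n by auto
  then have sub: "x ` {n-k..n} \<subseteq> S" by blast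
  have "\<exists>\<xi>\<in>S. deriv f (x n) - poly (pderiv p) (x n) =
      (deriv ^^ (k + 1)) f \<xi> / fact (k + 1) * (\<Prod>z\<in>x ` {n-k..n} - {x n}. x n - z)"
    by (rule interpolation_deriv_error[OF C S(1) sub _ k p(1)])
      (use p(2) n nodes(2) in \<open>auto simp: card_image\<close>)
  then obtain \<xi> where "\<xi> \<in> S" "deriv f (x n) - poly (pderiv p) (x n) =
      (deriv ^^ (k + 1)) f \<xi> / fact (k + 1) * (\<Prod>i=1..k. x n - x (n - i))"
    unfolding prod by blast
  moreover obtain \<zeta> where "\<zeta> \<in> S"
      "(x n - \<alpha>) * deriv f (x n) - f (x n) = (deriv ^^ 2) f \<zeta> / 2 * (x n - \<alpha>) ^ 2"
    using Taylor_quadratic_at_root[OF C _ S _ root, of "x n"] nodes(1)[of 0] k by auto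
  ultimately show ?thesis using that[of \<xi> \<zeta>] by (simp only: p_def eq_diff_eq diff_eq_eq add.commute)
qed

lemma Ck_on_subset: "Ck_on m f S \<Longrightarrow> T \<subseteq> S \<Longrightarrow> Ck_on m f T"
  by (auto simp: Ck_on_def intro: continuous_on_subset)

text \<open>In $\epsilon_{n+1} q = \epsilon_n (G \epsilon_n - E)$, where $q = f'(x_n) - E$, the correction satisfies
$|E| \leq 2 \delta D$. Smallness of $\delta$ makes $|q| \geq c/2$ and $|G \epsilon_n - E| \leq c/4$.\<close>

lemma secant_step_contraction:
  fixes x :: "nat \<Rightarrow> real"
  assumes k: "k \<ge> 1" and C: "Ck_on (k + 1) f (cball \<alpha> \<delta>)" and root: "f \<alpha> = 0"
    and n: "k \<le> n" and nodes: "\<And>i. i \<le> k \<Longrightarrow> \<bar>x (n - i) - \<alpha>\<bar> \<le> \<delta>" "inj_on x {n-k..n}"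
    and step: "x (Suc n) = x n - f (x n) / poly (pderiv (interp_poly f x n k)) (x n)"
    and c: "c > 0" "\<And>t. t \<in> cball \<alpha> \<delta> \<Longrightarrow> c \<le> \<bar>deriv f t\<bar>"
    and M: "M \<ge> 0" "\<And>t. t \<in> cball \<alpha> \<delta> \<Longrightarrow> \<bar>(deriv ^^ 2) f t\<bar> \<le> M"
    and D: "D \<ge> 0" "\<And>t. t \<in> cball \<alpha> \<delta> \<Longrightarrow> \<bar>(deriv ^^ (k + 1)) f t\<bar> \<le> D"
    and small: "0 < \<delta>" "2 * \<delta> \<le> 1" "8 * \<delta> * (M + D) \<le> c"
  shows "\<bar>x (Suc n) - \<alpha>\<bar> \<le> \<bar>x n - \<alpha>\<bar> / 2"
proof -
  let ?S = "cball \<alpha> \<delta>"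
  have inS: "x (n - i) \<in> ?S" if "i \<le> k" for i
    using nodes(1)[OF that] by (simp add: dist_real_def abs_minus_commute)
  have aS: "\<alpha> \<in> ?S" using small by simp
  obtain \<xi> \<zeta> where x: "\<xi> \<in> ?S" "\<zeta> \<in> ?S"
    "poly (pderiv (interp_poly f x n k)) (x n) =
       deriv f (x n) - (deriv ^^ (k + 1)) f \<xi> / fact (k + 1) * (\<Prod>i=1..k. x n - x (n - i))"
    "(x n - \<alpha>) * deriv f (x n) - f (x n) = (deriv ^^ 2) f \<zeta> / 2 * (x n - \<alpha>) ^ 2"
    using secant_step_error[OF k C is_interval_cball_1 aS root n inS nodes(2)] by blast
  define q where "q = poly (pderiv (interp_poly f x n k)) (x n)"
  define E where "E = (deriv ^^ (k + 1)) f \<xi> / fact (k + 1) * (\<Prod>i=1..k. x n - x (n - i))"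
  have q: "q = deriv f (x n) - E" using x(3) by (simp only: q_def E_def)
  have "(\<Prod>i=1..k. \<bar>x n - x (n - i)\<bar>) \<le> (\<Prod>i=1..k. 2 * \<delta>)"
  proof (rule prod_mono)
    fix i assume "i \<in> {1..k}"
    then show "0 \<le> \<bar>x n - x (n - i)\<bar> \<and> \<bar>x n - x (n - i)\<bar> \<le> 2 * \<delta>"
      using nodes(1)[of i] nodes(1)[of 0] by auto
  qed
  also have "\<dots> \<le> (2 * \<delta>) ^ 1"
    using k small power_decreasing[of 1 k "2 * \<delta>"] by simp
  finally have P: "\<bar>\<Prod>i=1..k. x n - x (n - i)\<bar> \<le> 2 * \<delta>" by (simp add: abs_prod)
  have "\<bar>(deriv ^^ (k + 1)) f \<xi> / fact (k + 1)\<bar> \<le> \<bar>(deriv ^^ (k + 1)) f \<xi>\<bar> / 1"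
    unfolding abs_divide using fact_ge_1[of "k + 1", where 'a = real] by (intro frac_le) auto
  also have "\<dots> \<le> D" using D(2)[OF x(1)] by simp
  finally have E: "\<bar>E\<bar> \<le> D * (2 * \<delta>)"
    unfolding E_def abs_mult using P D(1) by (intro mult_mono) auto
  have s3: "8 * (\<delta> * M) + 8 * (D * \<delta>) \<le> c" using small(3) by (simp add: algebra_simps)
  have s4: "0 \<le> \<delta> * M" "0 \<le> D * \<delta>" using small(1) M(1) D(1) by auto
  have Dd: "D * (2 * \<delta>) \<le> c / 4" using s3 s4 by linarith
  have "c \<le> \<bar>deriv f (x n)\<bar>" using c(2) inS[of 0] by simp
  then have qc: "c / 2 \<le> \<bar>q\<bar>" using E Dd c(1) unfolding q by linarith
  then have q0: "q \<noteq> 0" using c(1) by auto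
  have "(x (Suc n) - \<alpha>) * q = (x n - \<alpha>) * q - f (x n)"
    using step q0 by (simp add: q_def[symmetric] field_simps)
  also have "\<dots> = (x n - \<alpha>) * ((deriv ^^ 2) f \<zeta> / 2 * (x n - \<alpha>) - E)"
  proof -
    have "(x n - \<alpha>) * (d - E) - v = (x n - \<alpha>) * (g * (x n - \<alpha>) - E)"
      if "(x n - \<alpha>) * d - v = g * (x n - \<alpha>) ^ 2" for d g v
      using that by (simp add: algebra_simps power2_eq_square)
    from this[OF x(4)] show ?thesis unfolding q .
  qed
  finally have "\<bar>x (Suc n) - \<alpha>\<bar> * \<bar>q\<bar> = \<bar>x n - \<alpha>\<bar> * \<bar>(deriv ^^ 2) f \<zeta> / 2 * (x n - \<alpha>) - E\<bar>"
    by (simp only: abs_mult[symmetric])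
  also have "\<dots> \<le> \<bar>x n - \<alpha>\<bar> * (c / 4)"
  proof (rule mult_left_mono)
    have "\<bar>(deriv ^^ 2) f \<zeta> / 2 * (x n - \<alpha>)\<bar> \<le> M / 2 * \<delta>"
      unfolding abs_mult using M(1) M(2)[OF x(2)] nodes(1)[of 0] by (intro mult_mono) auto
    moreover have "M / 2 * \<delta> + D * (2 * \<delta>) \<le> c / 4"
    proof -
      have "M / 2 * \<delta> = \<delta> * M / 2" by simp
      then show ?thesis using s3 s4 by linarith
    qed
    ultimately show "\<bar>(deriv ^^ 2) f \<zeta> / 2 * (x n - \<alpha>) - E\<bar> \<le> c / 4"
      using E by linarith
  qed auto
  finally have "\<bar>x (Suc n) - \<alpha>\<bar> * (c / 2) \<le> \<bar>x n - \<alpha>\<bar> * (c / 4)"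
    using mult_left_mono[OF qc, of "\<bar>x (Suc n) - \<alpha>\<bar>"] by linarith
  then show ?thesis using c(1) by (simp add: field_simps)
qed

text \<open>The constants come from continuity of $f'$, $f''$ and $f^{(k+1)}$ at the root alone. A step with
$f(x_n) = 0$ needs separate treatment, since the interpolation polynomial may then be undetermined; in a small ball it
means $x_n = \alpha$, and the iteration stays there.\<close>

lemma secant_iteration_local_contraction:
  fixes f :: "real \<Rightarrow> real"
  assumes k: "k \<ge> 1" and I: "open I" "\<alpha> \<in> I" and C: "Ck_on (k + 1) f I"
    and root: "f \<alpha> = 0" "deriv f \<alpha> \<noteq> 0"
  obtains \<delta> where "\<delta> > 0" "cball \<alpha> \<delta> \<subseteq> I" "\<And>t. t \<in> cball \<alpha> \<delta> \<Longrightarrow> f t = 0 \<Longrightarrow> t = \<alpha>"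
    "\<And>x n. secant_iteration f k x \<Longrightarrow> (\<And>i. i \<le> k \<Longrightarrow> \<bar>x i - \<alpha>\<bar> \<le> \<delta>) \<Longrightarrow> \<bar>x n - \<alpha>\<bar> \<le> \<delta>"
    "\<And>x n. secant_iteration f k x \<Longrightarrow> (\<And>i. i \<le> k \<Longrightarrow> \<bar>x i - \<alpha>\<bar> \<le> \<delta>) \<Longrightarrow> n \<ge> k \<Longrightarrow>
       \<bar>x (Suc n) - \<alpha>\<bar> \<le> \<bar>x n - \<alpha>\<bar> / 2"
proof -
  define c where "c = \<bar>deriv f \<alpha>\<bar> / 2"
  define M where "M = \<bar>(deriv ^^ 2) f \<alpha>\<bar> + 1"
  define D where "D = \<bar>(deriv ^^ (k + 1)) f \<alpha>\<bar> + 1"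
  have pos: "c > 0" "M > 0" "D > 0" using root(2) by (auto simp: c_def M_def D_def)
  have lim: "((\<lambda>t. \<bar>(deriv ^^ j) f t\<bar>) \<longlongrightarrow> \<bar>(deriv ^^ j) f \<alpha>\<bar>) (nhds \<alpha>)" if "j \<le> k + 1" for j
    using Ck_on_isCont[OF C I(1) that I(2)] by (intro tendsto_rabs) (simp add: isCont_def tendsto_at_iff_tendsto_nhds)
  have "eventually (\<lambda>t. t \<in> I \<and> c < \<bar>deriv f t\<bar> \<and> \<bar>(deriv ^^ 2) f t\<bar> < M \<and> \<bar>(deriv ^^ (k + 1)) f t\<bar> < D) (nhds \<alpha>)"
    by (intro eventually_conj eventually_nhds_in_open I
        order_tendstoD(1)[OF lim[of 1, simplified]] order_tendstoD(2)[OF lim])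
      (use k root(2) in \<open>auto simp: c_def M_def D_def\<close>)
  then obtain e where e: "e > 0" "\<And>t. dist t \<alpha> < e \<Longrightarrow>
      t \<in> I \<and> c < \<bar>deriv f t\<bar> \<and> \<bar>(deriv ^^ 2) f t\<bar> < M \<and> \<bar>(deriv ^^ (k + 1)) f t\<bar> < D"
    unfolding eventually_nhds_metric by blast
  define \<delta> where "\<delta> = min (e / 2) (min (1 / 2) (c / (8 * (M + D))))"
  have \<delta>: "0 < \<delta>" "2 * \<delta> \<le> 1" "\<delta> < e" using e(1) pos by (auto simp: \<delta>_def min_less_iff_disj)
  have "\<delta> \<le> c / (8 * (M + D))" by (simp add: \<delta>_def)
  then have \<delta>c: "8 * \<delta> * (M + D) \<le> c" using pos by (simp add: field_simps)
  have b: "t \<in> I" "c \<le> \<bar>deriv f t\<bar>" "\<bar>(deriv ^^ 2) f t\<bar> \<le> M" "\<bar>(deriv ^^ (k + 1)) f t\<bar> \<le> D"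
    if "t \<in> cball \<alpha> \<delta>" for t
    using e(2)[of t] that \<delta>(3) by (auto simp: dist_commute)
  have sub: "cball \<alpha> \<delta> \<subseteq> I" using b(1) by blast
  have C': "Ck_on (k + 1) f (cball \<alpha> \<delta>)" using C sub by (rule Ck_on_subset)
  \<comment> \<open>At a second root the Taylor formula would give $f'(t) = f''(\zeta) (t - \alpha) / 2$, which is too small.\<close>
  have zero: "t = \<alpha>" if t: "t \<in> cball \<alpha> \<delta>" "f t = 0" for t
  proof (rule ccontr)
    assume "t \<noteq> \<alpha>"
    obtain \<zeta> where z: "\<zeta> \<in> cball \<alpha> \<delta>" "(t - \<alpha>) * deriv f t - f t = (deriv ^^ 2) f \<zeta> / 2 * (t - \<alpha>) ^ 2"
      using Taylor_quadratic_at_root[OF C' _ is_interval_cball_1 _ t(1) root(1)] k \<delta>(1) by auto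
    then have "deriv f t = (deriv ^^ 2) f \<zeta> / 2 * (t - \<alpha>)"
      using t(2) \<open>t \<noteq> \<alpha>\<close> by (simp add: power2_eq_square)
    then have "\<bar>deriv f t\<bar> = \<bar>(deriv ^^ 2) f \<zeta> / 2 * (t - \<alpha>)\<bar>" by simp
    also have "\<dots> \<le> M / 2 * \<delta>"
      unfolding abs_mult using b(3)[OF z(1)] t(1) pos
      by (intro mult_mono) (auto simp: dist_real_def abs_minus_commute)
    also have "\<dots> < 8 * \<delta> * (M + D)"
    proof -
      have "0 < \<delta> * M" "0 < \<delta> * D" using \<delta>(1) pos by auto
      moreover have "M / 2 * \<delta> = \<delta> * M / 2" by simp
      ultimately show ?thesis unfolding distrib_left by linarith
    qed
    finally show False using b(2)[OF t(1)] \<delta>c by linarith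
  qed
  have half: "\<bar>x (Suc n) - \<alpha>\<bar> \<le> \<bar>x n - \<alpha>\<bar> / 2"
    if it: "secant_iteration f k x" and n: "k \<le> n" and w: "\<And>i. i \<le> k \<Longrightarrow> \<bar>x (n - i) - \<alpha>\<bar> \<le> \<delta>" for x n
  proof (cases "f (x n) = 0")
    case True
    have "x n = \<alpha>" using zero[of "x n"] True w[of 0] by (simp add: dist_real_def abs_minus_commute)
    then show ?thesis using it n True by (simp add: secant_iteration_def)
  next
    case False
    show ?thesis
      by (rule secant_step_contraction[where x = x and c = c and M = M and D = D, OF k C' root(1) n w _ _ pos(1) b(2) _ b(3) _ b(4)])
        (use False it n pos \<delta> \<delta>c in \<open>auto simp: secant_iteration_def\<close>)
  qed
  have bdd: "\<bar>x n - \<alpha>\<bar> \<le> \<delta>"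
    if it: "secant_iteration f k x" and w: "\<And>i. i \<le> k \<Longrightarrow> \<bar>x i - \<alpha>\<bar> \<le> \<delta>" for x n
  proof (induction n rule: less_induct)
    case (less n)
    show ?case
    proof (cases "n \<le> k")
      case False
      then obtain m where m: "n = Suc m" "k \<le> m" by (cases n) auto
      have "\<bar>x n - \<alpha>\<bar> \<le> \<bar>x m - \<alpha>\<bar> / 2"
        unfolding m(1) by (rule half[OF it m(2)]) (use less m in auto)
      also have "\<dots> \<le> \<bar>x m - \<alpha>\<bar>" by simp
      also have "\<dots> \<le> \<delta>" using less m by simp
      finally show ?thesis .
    qed (use w in auto)
  qed
  show ?thesis
  proof (rule that[OF \<delta>(1) sub zero])
    fix x n
    assume it: "secant_iteration f k x" and w: "\<And>i. i \<le> k \<Longrightarrow> \<bar>x i - \<alpha>\<bar> \<le> \<delta>"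
    show "\<bar>x n - \<alpha>\<bar> \<le> \<delta>" using it w by (rule bdd)
    show "\<bar>x (Suc n) - \<alpha>\<bar> \<le> \<bar>x n - \<alpha>\<bar> / 2" if "n \<ge> k"
      using it that by (rule half) (use bdd[OF it w] in blast)
  qed
qed

lemma halving_decreasing:
  fixes E :: "nat \<Rightarrow> real"
  assumes "\<And>n. n \<ge> k \<Longrightarrow> \<bar>E (Suc n)\<bar> \<le> \<bar>E n\<bar> / 2" "k \<le> m" "m \<le> n"
  shows "\<bar>E n\<bar> \<le> \<bar>E m\<bar>"
  using assms(3)
proof (induction n rule: dec_induct)
  case (step n)
  have "\<bar>E (Suc n)\<bar> \<le> \<bar>E n\<bar> / 2" using assms(1)[of n] assms(2) step(1) by simp
  also have "\<dots> \<le> \<bar>E n\<bar>" by simp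
  finally show ?case using step(3) by simp
qed simp

lemma halving_tendsto_0:
  fixes E :: "nat \<Rightarrow> real"
  assumes "\<And>n. n \<ge> k \<Longrightarrow> \<bar>E (Suc n)\<bar> \<le> \<bar>E n\<bar> / 2"
  shows "E \<longlonglongrightarrow> 0"
proof -
  have "\<bar>E (n + k)\<bar> \<le> (1 / 2) ^ n * \<bar>E k\<bar>" for n
  proof (induction n)
    case (Suc n)
    then show ?case using assms[of "n + k"] by simp
  qed simp
  moreover have "(\<lambda>n. (1 / 2) ^ n * \<bar>E k\<bar>) \<longlonglongrightarrow> 0 * \<bar>E k\<bar>"
    by (intro tendsto_intros LIMSEQ_power_zero) auto
  ultimately have "(\<lambda>n. E (n + k)) \<longlonglongrightarrow> 0"
    by (intro Lim_null_comparison[of "\<lambda>n. E (n + k)" "\<lambda>n. (1 / 2) ^ n * \<bar>E k\<bar>"]) auto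
  then show ?thesis by (rule LIMSEQ_offset)
qed

section \<open>The limit of the error quotient\<close>

text \<open>Once $|a_n| \leq 1/2$ the recurrence keeps \<open>R\<close> bounded; then $a_n R_n \to 0$.\<close>

lemma affine_recurrence_tendsto:
  fixes R a c :: "nat \<Rightarrow> real"
  assumes a: "a \<longlonglongrightarrow> 0" and c: "c \<longlonglongrightarrow> L"
    and rec: "\<forall>\<^sub>F n in sequentially. R (Suc n) = a n * R n + c n"
  shows "R \<longlonglongrightarrow> L"
proof -
  have "Bseq c" using c by (intro convergent_imp_Bseq) (auto simp: convergent_def)
  then obtain K where K: "K > 0" "\<And>n. \<bar>c n\<bar> \<le> K" by (auto simp: Bseq_def)
  have "\<forall>\<^sub>F n in sequentially. \<bar>a n\<bar> < 1 / 2"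
    using tendsto_rabs[OF a] by (intro order_tendstoD(2)) auto
  with rec have "\<forall>\<^sub>F n in sequentially. R (Suc n) = a n * R n + c n \<and> \<bar>a n\<bar> < 1 / 2"
    by (rule eventually_conj)
  then obtain N where N: "\<And>n. n \<ge> N \<Longrightarrow> R (Suc n) = a n * R n + c n" "\<And>n. n \<ge> N \<Longrightarrow> \<bar>a n\<bar> < 1 / 2"
    by (auto simp: eventually_sequentially)
  have Rb: "\<bar>R (n + N)\<bar> \<le> \<bar>R N\<bar> + 2 * K" for n
  proof (induction n)
    case (Suc n)
    have "\<bar>R (Suc n + N)\<bar> \<le> \<bar>a (n + N)\<bar> * \<bar>R (n + N)\<bar> + \<bar>c (n + N)\<bar>"
      using N(1)[of "n + N"] abs_triangle_ineq[of "a (n + N) * R (n + N)"] by (simp add: abs_mult)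
    also have "\<dots> \<le> 1 / 2 * (\<bar>R N\<bar> + 2 * K) + K"
      using N(2)[of "n + N"] Suc K(2) by (intro add_mono mult_mono) auto
    also have "\<dots> \<le> \<bar>R N\<bar> + 2 * K" by simp
    finally show ?case .
  qed (use K in auto)
  have "norm (R n) \<le> \<bar>R N\<bar> + 2 * K" if "n \<ge> N" for n
    using Rb[of "n - N"] that by simp
  then have "\<forall>\<^sub>F n in sequentially. norm (R n) \<le> \<bar>R N\<bar> + 2 * K"
    by (auto intro: eventually_sequentiallyI)
  with a have "(\<lambda>n. a n * R n) \<longlonglongrightarrow> 0" by (rule lim_null_mult_right_bounded)
  then have "(\<lambda>n. a n * R n + c n) \<longlonglongrightarrow> 0 + L" using c by (intro tendsto_add)
  then have "(\<lambda>n. R (Suc n)) \<longlonglongrightarrow> L"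
    by (simp add: tendsto_cong[OF rec])
  then show ?thesis by (rule LIMSEQ_imp_Suc)
qed

text \<open>Discarding the Newton term directly would require that $\epsilon_n$ is of order $\prod_{i=1}^{k+1} \epsilon_{n-i}$,
which is the claim itself one step earlier. The affine recurrence for the quotient removes this circularity.\<close>

lemma secant_error_quotient_limit:
  fixes f :: "real \<Rightarrow> real" and x :: "nat \<Rightarrow> real"
  assumes k: "k \<ge> 1" and I: "open I" "\<alpha> \<in> I" and C: "Ck_on (k + 1) f I"
    and root: "f \<alpha> = 0" "deriv f \<alpha> \<noteq> 0"
    and \<delta>: "cball \<alpha> \<delta> \<subseteq> I" "\<And>t. t \<in> cball \<alpha> \<delta> \<Longrightarrow> f t = 0 \<Longrightarrow> t = \<alpha>"
    and it: "secant_iteration f k x" and bdd: "\<And>n. \<bar>x n - \<alpha>\<bar> \<le> \<delta>"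
    and half: "\<And>n. n \<ge> k \<Longrightarrow> \<bar>x (Suc n) - \<alpha>\<bar> \<le> \<bar>x n - \<alpha>\<bar> / 2"
    and ne: "\<And>n. n \<ge> k \<Longrightarrow> x n \<noteq> \<alpha>"
  shows "(\<lambda>n. (x (Suc n) - \<alpha>) / (\<Prod>i\<le>k. (x (n - i) - \<alpha>))) \<longlonglongrightarrow>
    (-1) ^ (k + 1) / fact (k + 1) * ((deriv ^^ (k + 1)) f \<alpha> / deriv f \<alpha>)"
proof -
  define E where "E = (\<lambda>n. x n - \<alpha>)"
  have E0: "E \<longlonglongrightarrow> 0" and mono: "k \<le> m \<Longrightarrow> m \<le> n \<Longrightarrow> \<bar>E n\<bar> \<le> \<bar>E m\<bar>" for m n
    using halving_tendsto_0[of k E] halving_decreasing[of k E m n] half by (auto simp: E_def)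
  have Enz: "E n \<noteq> 0" if "n \<ge> k" for n using ne that by (simp add: E_def)
  have shift: "(\<lambda>n. E (n - j)) \<longlonglongrightarrow> 0" for j
    by (rule LIMSEQ_offset[of _ j]) (simp add: E0)
  have x0: "x \<longlonglongrightarrow> \<alpha>" using E0 unfolding E_def by (rule LIM_zero_cancel)

  define F where "F = (\<lambda>t. (deriv ^^ (k + 1)) f t / fact (k + 1))"
  define G where "G = (\<lambda>t. (deriv ^^ 2) f t / 2)"
  define P where "P = (\<lambda>n. \<Prod>i=1..k. E n - E (n - i))"
  define q where "q = (\<lambda>n. poly (pderiv (interp_poly f x n k)) (x n))"
  have Pdiff: "P n = (\<Prod>i=1..k. x n - x (n - i))" for n by (simp add: P_def E_def)
  \<comment> \<open>From index $2k$ on, the errors decrease over the whole window, so its oldest error bounds all others.\<close>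
  have "\<forall>n\<ge>2*k. \<exists>\<xi> \<zeta>. \<bar>\<xi> - \<alpha>\<bar> \<le> \<bar>E (n - k)\<bar> \<and> \<bar>\<zeta> - \<alpha>\<bar> \<le> \<bar>E (n - k)\<bar> \<and>
      q n = deriv f (x n) - F \<xi> * P n \<and> E n * deriv f (x n) - f (x n) = G \<zeta> * (E n)\<^sup>2"
  proof (intro allI impI)
    fix n assume n: "2 * k \<le> n"
    let ?S = "cball \<alpha> \<bar>E (n - k)\<bar>"
    have fn: "f (x n) \<noteq> 0"
      using \<delta>(2)[of "x n"] bdd[of n] ne[of n] n by (auto simp: dist_real_def abs_minus_commute)
    have "?S \<subseteq> cball \<alpha> \<delta>" using bdd[of "n - k"] by (intro subset_cball) (simp add: E_def)
    then have C': "Ck_on (k + 1) f ?S" using C \<delta>(1) by (blast intro: Ck_on_subset)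
    have nodes: "x (n - i) \<in> ?S" if "i \<le> k" for i
      using mono[of "n - k" "n - i"] that n by (simp add: E_def dist_real_def abs_minus_commute)
    have inj: "inj_on x {n-k..n}" using it fn n by (auto simp: secant_iteration_def)
    have "\<alpha> \<in> ?S" "k \<le> n" using n by auto
    then obtain \<xi> \<zeta> where "\<xi> \<in> ?S" "\<zeta> \<in> ?S"
      "poly (pderiv (interp_poly f x n k)) (x n) =
         deriv f (x n) - (deriv ^^ (k + 1)) f \<xi> / fact (k + 1) * (\<Prod>i=1..k. x n - x (n - i))"
      "(x n - \<alpha>) * deriv f (x n) - f (x n) = (deriv ^^ 2) f \<zeta> / 2 * (x n - \<alpha>) ^ 2"
      using secant_step_error[OF k C' is_interval_cball_1 _ root(1) _ nodes inj] by blast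
    then have "\<xi> \<in> ?S" "\<zeta> \<in> ?S"
      "q n = deriv f (x n) - F \<xi> * P n" "E n * deriv f (x n) - f (x n) = G \<zeta> * (E n)\<^sup>2"
      unfolding q_def Pdiff F_def G_def E_def by blast+
    then show "\<exists>\<xi> \<zeta>. \<bar>\<xi> - \<alpha>\<bar> \<le> \<bar>E (n - k)\<bar> \<and> \<bar>\<zeta> - \<alpha>\<bar> \<le> \<bar>E (n - k)\<bar> \<and>
      q n = deriv f (x n) - F \<xi> * P n \<and> E n * deriv f (x n) - f (x n) = G \<zeta> * (E n)\<^sup>2"
      by (intro exI[of _ \<xi>] exI[of _ \<zeta>]) (auto simp: dist_real_def abs_minus_commute)
  qed
  then obtain \<xi> \<zeta> where \<xi>: "\<And>n. n \<ge> 2 * k \<Longrightarrow> \<bar>\<xi> n - \<alpha>\<bar> \<le> \<bar>E (n - k)\<bar>"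
    and \<zeta>: "\<And>n. n \<ge> 2 * k \<Longrightarrow> \<bar>\<zeta> n - \<alpha>\<bar> \<le> \<bar>E (n - k)\<bar>"
    and q: "\<And>n. n \<ge> 2 * k \<Longrightarrow> q n = deriv f (x n) - F (\<xi> n) * P n"
    and T: "\<And>n. n \<ge> 2 * k \<Longrightarrow> E n * deriv f (x n) - f (x n) = G (\<zeta> n) * (E n)\<^sup>2"
    by metis

  have sq: "y \<longlonglongrightarrow> \<alpha>" if "\<And>n. n \<ge> 2 * k \<Longrightarrow> \<bar>y n - \<alpha>\<bar> \<le> \<bar>E (n - k)\<bar>" for y
  proof (rule LIM_zero_cancel, rule Lim_null_comparison)
    show "\<forall>\<^sub>F n in sequentially. norm (y n - \<alpha>) \<le> \<bar>E (n - k)\<bar>"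
      using that by (auto intro: eventually_sequentiallyI)
    show "(\<lambda>n. \<bar>E (n - k)\<bar>) \<longlonglongrightarrow> 0" using tendsto_rabs[OF shift] by simp
  qed
  have cont: "(\<lambda>n. (deriv ^^ j) f (y n)) \<longlonglongrightarrow> (deriv ^^ j) f \<alpha>" if "j \<le> k + 1" "y \<longlonglongrightarrow> \<alpha>" for j y
    using isCont_tendsto_compose[OF Ck_on_isCont[OF C I(1) that(1) I(2)] that(2)] .
  have Flim: "(\<lambda>n. F (\<xi> n)) \<longlonglongrightarrow> F \<alpha>"
    unfolding F_def by (intro tendsto_divide cont sq \<xi> tendsto_const) auto
  have Glim: "(\<lambda>n. G (\<zeta> n)) \<longlonglongrightarrow> G \<alpha>"
    unfolding G_def using k by (intro tendsto_divide cont sq \<zeta> tendsto_const) auto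
  have Plim: "P \<longlonglongrightarrow> 0"
  proof -
    have "P \<longlonglongrightarrow> (\<Prod>i=1..k. 0 - 0)"
      unfolding P_def by (intro tendsto_prod tendsto_diff shift E0)
    then show ?thesis using k by (simp add: power_0_left)
  qed
  have qlim: "q \<longlonglongrightarrow> deriv f \<alpha>"
  proof -
    have "(\<lambda>n. deriv f (x n) - F (\<xi> n) * P n) \<longlonglongrightarrow> deriv f \<alpha> - F \<alpha> * 0"
      using cont[of 1 x] x0 by (intro tendsto_diff tendsto_mult Flim Plim) auto
    then show ?thesis
      using q by (subst tendsto_cong[of q]) (auto intro: eventually_sequentiallyI)
  qed
  have qnz: "\<forall>\<^sub>F n in sequentially. q n \<noteq> 0"
    using qlim root(2) by (rule tendsto_imp_eventually_ne)
  have step: "E (Suc n) = E n * (G (\<zeta> n) * E n - F (\<xi> n) * P n) / q n" if "n \<ge> 2 * k" "q n \<noteq> 0" for n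
  proof -
    have "x (Suc n) = x n - f (x n) / q n"
      using it that(1) by (simp add: secant_iteration_def q_def)
    then have "E (Suc n) * q n = E n * q n - f (x n)"
      using that(2) by (simp add: E_def field_simps)
    also have "\<dots> = E n * (G (\<zeta> n) * E n - F (\<xi> n) * P n)"
    proof -
      have "E n * q n - f (x n) = (E n * deriv f (x n) - f (x n)) - E n * (F (\<xi> n) * P n)"
        by (simp add: q[OF that(1)] algebra_simps)
      also have "\<dots> = G (\<zeta> n) * (E n)\<^sup>2 - E n * (F (\<xi> n) * P n)"
        by (simp only: T[OF that(1)])
      finally show ?thesis by (simp add: algebra_simps power2_eq_square)
    qed
    finally show ?thesis using that(2) by (simp add: field_simps)
  qed
  have ev: "\<forall>\<^sub>F n in sequentially. n \<ge> 2 * k + 1 \<and> q n \<noteq> 0"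
    using qnz by (intro eventually_conj eventually_ge_at_top)

  have superlin: "(\<lambda>n. E (Suc n) / E n) \<longlonglongrightarrow> 0"
  proof -
    have "(\<lambda>n. (G (\<zeta> n) * E n - F (\<xi> n) * P n) / q n) \<longlonglongrightarrow> (G \<alpha> * 0 - F \<alpha> * 0) / deriv f \<alpha>"
      by (intro tendsto_intros Glim Flim Plim qlim E0 root)
    moreover have "\<forall>\<^sub>F n in sequentially. (G (\<zeta> n) * E n - F (\<xi> n) * P n) / q n = E (Suc n) / E n"
      using ev by eventually_elim (use step Enz in auto)
    ultimately show ?thesis by (simp add: Lim_transform_eventually)
  qed
  have ratio: "(\<lambda>n. E n / E (n - i)) \<longlonglongrightarrow> 0" if i: "i \<ge> 1" for i
  proof (rule Lim_null_comparison)
    have "(\<lambda>n. E n / E (n - 1)) \<longlonglongrightarrow> 0"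
      by (rule LIMSEQ_offset[of _ 1]) (use superlin in simp)
    then show "(\<lambda>n. \<bar>E n / E (n - 1)\<bar>) \<longlonglongrightarrow> 0" by (rule tendsto_rabs_zero)
    have "\<bar>E n / E (n - i)\<bar> \<le> \<bar>E n / E (n - 1)\<bar>" if n: "n \<ge> k + i" for n
      unfolding abs_divide using mono[of "n - i" "n - 1"] Enz[of "n - 1"] Enz[of "n - i"] i n
      by (intro divide_left_mono) auto
    then show "\<forall>\<^sub>F n in sequentially. norm (E n / E (n - i)) \<le> \<bar>E n / E (n - 1)\<bar>"
      by (auto intro: eventually_sequentiallyI)
  qed
  define \<rho> where "\<rho> = (\<lambda>n. P n / (\<Prod>i=1..k. E (n - i)))"
  have \<rho>: "\<rho> \<longlonglongrightarrow> (-1) ^ k"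
  proof -
    have "(\<lambda>n. \<Prod>i=1..k. E n / E (n - i) - 1) \<longlonglongrightarrow> (\<Prod>i=1..k. 0 - 1)"
      by (intro tendsto_prod tendsto_diff ratio tendsto_const) auto
    moreover have "(\<Prod>i=1..k. E n / E (n - i) - 1) = \<rho> n" if "n \<ge> 2 * k" for n
      unfolding \<rho>_def P_def prod_dividef[symmetric]
      by (rule prod.cong) (use Enz that in \<open>auto simp: diff_divide_distrib\<close>)
    then have "\<forall>\<^sub>F n in sequentially. (\<Prod>i=1..k. E n / E (n - i) - 1) = \<rho> n"
      by (auto intro: eventually_sequentiallyI)
    ultimately show ?thesis by (simp add: Lim_transform_eventually)
  qed

  define R where "R = (\<lambda>n. E (Suc n) / (\<Prod>i\<le>k. E (n - i)))"
  define a where "a = (\<lambda>n. G (\<zeta> n) * E (n - Suc k) / q n)"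
  define c where "c = (\<lambda>n. - (F (\<xi> n) * \<rho> n) / q n)"
  \<comment> \<open>The factor $\epsilon_{n-k-1}$ in \<open>a\<close> arises from $\epsilon_n / \prod_{i=1}^k \epsilon_{n-i} = \epsilon_{n-k-1} R_{n-1}$.\<close>
  have rec: "R n = a n * R (n - 1) + c n" if n: "n \<ge> 2 * k + 1" "q n \<noteq> 0" for n
  proof -
    let ?Q = "\<Prod>i=1..k. E (n - i)"
    have nz: "?Q \<noteq> 0" "E n \<noteq> 0" "E (n - Suc k) \<noteq> 0" using Enz n by auto
    have "{..k} = insert 0 {1..k}" by auto
    then have Q0: "(\<Prod>i\<le>k. E (n - i)) = E n * ?Q" by simp
    have "(\<Prod>i\<le>k. E (n - 1 - i)) = (\<Prod>i=1..Suc k. E (n - i))"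
      using prod.atLeast_Suc_atMost_Suc_shift[of "\<lambda>i. E (n - i)" 0 k] by (simp add: atMost_atLeast0)
    also have "\<dots> = ?Q * E (n - Suc k)" by simp
    finally have Q1: "(\<Prod>i\<le>k. E (n - 1 - i)) = ?Q * E (n - Suc k)" .
    have "R n = (G (\<zeta> n) * (E n / ?Q) - F (\<xi> n) * \<rho> n) / q n"
      unfolding R_def Q0 using step[of n] n nz by (simp add: \<rho>_def diff_divide_distrib mult.commute)
    also have "E n / ?Q = E (n - Suc k) * R (n - 1)"
      unfolding R_def Q1 using nz n by simp
    finally show ?thesis by (simp add: a_def c_def diff_divide_distrib)
  qed
  have "R \<longlonglongrightarrow> - (F \<alpha> * (-1) ^ k) / deriv f \<alpha>"
  proof (rule affine_recurrence_tendsto)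
    have "a \<longlonglongrightarrow> G \<alpha> * 0 / deriv f \<alpha>"
      unfolding a_def by (intro tendsto_intros Glim qlim shift root)
    then show "(\<lambda>n. a (Suc n)) \<longlonglongrightarrow> 0" by (simp add: LIMSEQ_Suc)
    have "c \<longlonglongrightarrow> - (F \<alpha> * (-1) ^ k) / deriv f \<alpha>"
      unfolding c_def by (intro tendsto_intros Flim qlim \<rho> root)
    then show "(\<lambda>n. c (Suc n)) \<longlonglongrightarrow> - (F \<alpha> * (-1) ^ k) / deriv f \<alpha>" by (rule LIMSEQ_Suc)
    have "\<forall>\<^sub>F n in sequentially. Suc n \<ge> 2 * k + 1 \<and> q (Suc n) \<noteq> 0"
      using ev by (rule eventually_sequentially_Suc[THEN iffD2])
    then show "\<forall>\<^sub>F n in sequentially. R (Suc n) = a (Suc n) * R n + c (Suc n)"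
      by eventually_elim (use rec in auto)
  qed
  then show ?thesis by (simp add: R_def E_def F_def mult.commute)
qed

section \<open>Polynomials: Newton's method\<close>

lemma higher_deriv_eq_poly:
  fixes P :: "real poly"
  assumes "open I" "\<And>t. t \<in> I \<Longrightarrow> f t = poly P t" "t \<in> I"
  shows "(deriv ^^ j) f t = poly ((pderiv ^^ j) P) t"
  using assms(3)
proof (induction j arbitrary: t)
  case (Suc j)
  have "eventually (\<lambda>t. (deriv ^^ j) f t = poly ((pderiv ^^ j) P) t) (nhds t)"
    using eventually_nhds_in_open[OF assms(1) Suc.prems] by eventually_elim (rule Suc.IH)
  then have "deriv ((deriv ^^ j) f) t = deriv (poly ((pderiv ^^ j) P)) t"
    by (rule deriv_cong_ev) simp
  also have "\<dots> = poly (pderiv ((pderiv ^^ j) P)) t"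
    using poly_DERIV by (rule DERIV_imp_deriv)
  finally show ?case by simp
qed (use assms(2) in simp)

text \<open>The numerator of the Newton error $t - P(t)/P'(t) - \alpha = ((t-\alpha) P'(t) - P(t))/P'(t)$ has derivative
$(t - \alpha) P''(t)$, so $\alpha$ is a double root of it.\<close>

lemma newton_defect_factor:
  fixes P :: "real poly"
  assumes "poly P \<alpha> = 0"
  obtains Q where "[:- \<alpha>, 1:] * pderiv P - P = [:- \<alpha>, 1:] ^ 2 * Q"
    "poly (pderiv (pderiv P)) \<alpha> = 2 * poly Q \<alpha>"
proof -
  define X where "X = [:- \<alpha>, 1:]"
  have X: "pderiv X = 1" "poly X \<alpha> = 0" "X \<noteq> 0"
    by (simp_all add: X_def pderiv_pCons)
  have dvd: "\<exists>q. p = X * q" if "poly p \<alpha> = 0" for p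
    using that by (auto simp: poly_eq_0_iff_dvd X_def dvd_def)
  define R where "R = X * pderiv P - P"
  have "poly R \<alpha> = 0" using assms by (simp add: R_def X)
  then obtain R1 where R1: "R = X * R1" using dvd by blast
  have R': "pderiv R = X * pderiv (pderiv P)"
    by (simp add: R_def pderiv_diff pderiv_mult X)
  have "pderiv R = R1 + X * pderiv R1" by (simp add: R1 pderiv_mult X)
  then have "poly R1 \<alpha> = 0" using arg_cong[OF R', of "\<lambda>p. poly p \<alpha>"] by (simp add: X)
  then obtain Q where Q: "R1 = X * Q" using dvd by blast
  have "pderiv R = X * (2 * Q + X * pderiv Q)"
    by (simp add: R1 Q pderiv_mult X algebra_simps)
  then have "pderiv (pderiv P) = 2 * Q + X * pderiv Q"
    using R' X(3) by simp
  then have "poly (pderiv (pderiv P)) \<alpha> = 2 * poly Q \<alpha>" by (simp add: X)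
  moreover have "X * pderiv P - P = X ^ 2 * Q"
    using R1 Q by (simp add: R_def power2_eq_square mult.assoc)
  ultimately show ?thesis using that unfolding X_def by blast
qed

text \<open>The error satisfies $\epsilon_{n+1} = \epsilon_n^2 \, Q(x_n)/P'(x_n)$ exactly, and $Q = (X-\alpha)^j U$ with
$U(\alpha) \neq 0$ gives order $j + 2$. Thus a vanishing second derivative still yields convergence with a definite
(integer) order above $2$.\<close>

lemma newton_order_polynomial:
  fixes P :: "real poly" and x :: "nat \<Rightarrow> real"
  assumes root: "poly P \<alpha> = 0" "poly (pderiv P) \<alpha> \<noteq> 0"
    and step: "\<And>n. n \<ge> N \<Longrightarrow> x (Suc n) = x n - poly P (x n) / poly (pderiv P) (x n)"
    and x0: "x \<longlonglongrightarrow> \<alpha>" and ne: "\<And>n. n \<ge> N \<Longrightarrow> x n \<noteq> \<alpha>"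
  shows "(\<lambda>n. (x (Suc n) - \<alpha>) / (x n - \<alpha>) ^ 2) \<longlonglongrightarrow>
           poly (pderiv (pderiv P)) \<alpha> / (2 * poly (pderiv P) \<alpha>)"
    and "\<exists>m\<ge>2. converges_with_order x \<alpha> (real m) \<and> (m = 2 \<longleftrightarrow> poly (pderiv (pderiv P)) \<alpha> \<noteq> 0)"
proof -
  obtain Q where Q: "[:- \<alpha>, 1:] * pderiv P - P = [:- \<alpha>, 1:] ^ 2 * Q"
    "poly (pderiv (pderiv P)) \<alpha> = 2 * poly Q \<alpha>"
    using newton_defect_factor[OF root(1)] by blast
  have lim: "(\<lambda>n. poly p (x n)) \<longlonglongrightarrow> poly p \<alpha>" for p
    by (intro tendsto_poly x0)
  have ev: "\<forall>\<^sub>F n in sequentially. n \<ge> N \<and> poly (pderiv P) (x n) \<noteq> 0"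
    using tendsto_imp_eventually_ne[OF lim root(2)] by (intro eventually_conj eventually_ge_at_top)
  have err: "x (Suc n) - \<alpha> = (x n - \<alpha>) ^ 2 * poly Q (x n) / poly (pderiv P) (x n)"
    if "n \<ge> N" "poly (pderiv P) (x n) \<noteq> 0" for n
  proof -
    have "(x n - \<alpha>) * poly (pderiv P) (x n) - poly P (x n) = (x n - \<alpha>) ^ 2 * poly Q (x n)"
      using arg_cong[OF Q(1), of "\<lambda>p. poly p (x n)"] by (simp add: left_diff_distrib)
    then show ?thesis using step[OF that(1)] that(2) by (simp add: field_simps)
  qed
  have "(\<lambda>n. poly Q (x n) / poly (pderiv P) (x n)) \<longlonglongrightarrow> poly Q \<alpha> / poly (pderiv P) \<alpha>"
    by (intro tendsto_divide lim root)
  moreover have "\<forall>\<^sub>F n in sequentially. poly Q (x n) / poly (pderiv P) (x n) = (x (Suc n) - \<alpha>) / (x n - \<alpha>) ^ 2"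
    using ev by eventually_elim (use err ne in auto)
  ultimately show "(\<lambda>n. (x (Suc n) - \<alpha>) / (x n - \<alpha>) ^ 2) \<longlonglongrightarrow>
           poly (pderiv (pderiv P)) \<alpha> / (2 * poly (pderiv P) \<alpha>)"
    by (simp add: Q(2) Lim_transform_eventually)
  \<comment> \<open>Otherwise the next iterate would be the root itself.\<close>
  have "Q \<noteq> 0"
  proof
    assume "Q = 0"
    obtain n where "n \<ge> N" "poly (pderiv P) (x n) \<noteq> 0" using ev by (auto simp: eventually_sequentially)
    then show False using err[of n] ne[of "Suc n"] \<open>Q = 0\<close> by simp
  qed
  define j where "j = order \<alpha> Q"
  obtain U where U: "Q = [:- \<alpha>, 1:] ^ j * U" "\<not> [:- \<alpha>, 1:] dvd U"
    using order_decomp[OF \<open>Q \<noteq> 0\<close>] unfolding j_def by blast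
  have U0: "poly U \<alpha> \<noteq> 0" using U(2) by (simp add: poly_eq_0_iff_dvd)
  have "(\<lambda>n. \<bar>poly U (x n) / poly (pderiv P) (x n)\<bar>) \<longlonglongrightarrow> \<bar>poly U \<alpha> / poly (pderiv P) \<alpha>\<bar>"
    by (intro tendsto_rabs tendsto_divide lim root)
  moreover have "\<forall>\<^sub>F n in sequentially. \<bar>poly U (x n) / poly (pderiv P) (x n)\<bar> =
      \<bar>x (Suc n) - \<alpha>\<bar> / \<bar>x n - \<alpha>\<bar> powr real (j + 2)"
    using ev
  proof eventually_elim
    case (elim n)
    then have "\<bar>x n - \<alpha>\<bar> > 0" using ne[of n] by simp
    moreover have "x (Suc n) - \<alpha> = (x n - \<alpha>) ^ (j + 2) * (poly U (x n) / poly (pderiv P) (x n))"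
      using err[of n] elim by (simp add: U(1) power_add power2_eq_square)
    then have "\<bar>x (Suc n) - \<alpha>\<bar> =
        \<bar>x n - \<alpha>\<bar> ^ (j + 2) * \<bar>poly U (x n) / poly (pderiv P) (x n)\<bar>"
      by (simp only: abs_mult power_abs)
    ultimately show ?case by (simp only: powr_realpow) simp
  qed
  ultimately have "(\<lambda>n. \<bar>x (Suc n) - \<alpha>\<bar> / \<bar>x n - \<alpha>\<bar> powr real (j + 2)) \<longlonglongrightarrow> \<bar>poly U \<alpha> / poly (pderiv P) \<alpha>\<bar>"
    by (rule Lim_transform_eventually)
  then have "converges_with_order x \<alpha> (real (j + 2))"
    unfolding converges_with_order_def using x0 U0 root(2)
    by (intro conjI exI[of _ "\<bar>poly U \<alpha> / poly (pderiv P) \<alpha>\<bar>"]) auto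
  moreover have "j = 0 \<longleftrightarrow> poly Q \<alpha> \<noteq> 0"
    using \<open>Q \<noteq> 0\<close> by (simp add: j_def order_root)
  ultimately show "\<exists>m\<ge>2. converges_with_order x \<alpha> (real m) \<and> (m = 2 \<longleftrightarrow> poly (pderiv (pderiv P)) \<alpha> \<noteq> 0)"
    by (intro exI[of _ "j + 2"]) (auto simp: Q(2))
qed

lemma secant_iteration_interpolates_polynomial:
  fixes P :: "real poly"
  assumes "k \<le> n" "inj_on x {n-k..n}" "degree P \<le> k" "\<And>i. i \<in> {n-k..n} \<Longrightarrow> f (x i) = poly P (x i)"
  shows "interp_poly f x n k = P"
  unfolding interp_poly_def
  by (rule the1_equality[OF interp_poly_ex1]) (use assms in auto)

section \<open>Convergence and order of the iteration\<close>

theorem theorem3p1: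
  fixes f :: "real \<Rightarrow> real" and \<alpha> :: real and I :: "real set" and k :: nat
  assumes "k \<ge> 2"
    and "open I" and "is_interval I" and "\<alpha> \<in> I"
    and "Ck_on (k + 1) f I"
    and "f \<alpha> = 0" and "deriv f \<alpha> \<noteq> 0"
  shows
    "(\<exists>!s::real. s > 0 \<and> s ^ (k + 1) = (\<Sum>i\<le>k. s ^ i)) \<and>
     1 < secant_order k \<and> secant_order k < 2 \<and>
     2 - exp 1 / 2 ^ (k + 1) < secant_order k \<and> secant_order k < 2 - 1 / 2 ^ (k + 1) \<and>
     secant_order k < secant_order (k + 1) \<and>
     secant_order \<longlonglongrightarrow> 2 \<and>
     (\<exists>\<delta>>0. \<forall>x :: nat \<Rightarrow> real.
        inj_on x {..k} \<and> (\<forall>i\<le>k. x i \<in> I \<and> \<bar>x i - \<alpha>\<bar> < \<delta>) \<and> secant_iteration f k x \<longrightarrow>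
        ((deriv ^^ (k + 1)) f \<alpha> \<noteq> 0 \<longrightarrow>
           x \<longlonglongrightarrow> \<alpha> \<and>
           ((\<forall>n\<ge>k. x n \<noteq> \<alpha>) \<longrightarrow>
             (let L = (-1) ^ (k + 1) / fact (k + 1) * ((deriv ^^ (k + 1)) f \<alpha> / deriv f \<alpha>) in
               (\<lambda>n. (x (Suc n) - \<alpha>) / (\<Prod>i\<le>k. (x (n - i) - \<alpha>))) \<longlonglongrightarrow> L \<and>
               converges_with_order x \<alpha> (secant_order k) \<and>
               (\<lambda>n. \<bar>x (Suc n) - \<alpha>\<bar> / \<bar>x n - \<alpha>\<bar> powr secant_order k)
                 \<longlonglongrightarrow> \<bar>L\<bar> powr ((secant_order k - 1) / real k)))) \<and>
        ((\<exists>P :: real poly. degree P \<le> k \<and> (\<forall>t\<in>I. f t = poly P t)) \<longrightarrow>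
           x \<longlonglongrightarrow> \<alpha> \<and>
           ((\<forall>n\<ge>k. x n \<noteq> \<alpha>) \<longrightarrow>
             (\<lambda>n. (x (Suc n) - \<alpha>) / (x n - \<alpha>) ^ 2)
               \<longlonglongrightarrow> (deriv ^^ 2) f \<alpha> / (2 * deriv f \<alpha>) \<and>
             ((deriv ^^ 2) f \<alpha> \<noteq> 0 \<longrightarrow> converges_with_order x \<alpha> 2) \<and>
             ((deriv ^^ 2) f \<alpha> = 0 \<longrightarrow> (\<exists>s>2. converges_with_order x \<alpha> s)))))"
proof -
  note k = \<open>k \<ge> 2\<close>
  have k1: "k \<ge> 1" using k by simp
  note root = \<open>f \<alpha> = 0\<close> \<open>deriv f \<alpha> \<noteq> 0\<close> and I = \<open>open I\<close> \<open>\<alpha> \<in> I\<close> and C = \<open>Ck_on (k + 1) f I\<close>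
  let ?s = "secant_order k"
  obtain \<delta> where \<delta>: "\<delta> > 0" "cball \<alpha> \<delta> \<subseteq> I"
    and zero: "\<And>t. t \<in> cball \<alpha> \<delta> \<Longrightarrow> f t = 0 \<Longrightarrow> t = \<alpha>"
    and bdd: "\<And>x n. secant_iteration f k x \<Longrightarrow> (\<And>i. i \<le> k \<Longrightarrow> \<bar>x i - \<alpha>\<bar> \<le> \<delta>) \<Longrightarrow> \<bar>x n - \<alpha>\<bar> \<le> \<delta>"
    and half: "\<And>x n. secant_iteration f k x \<Longrightarrow> (\<And>i. i \<le> k \<Longrightarrow> \<bar>x i - \<alpha>\<bar> \<le> \<delta>) \<Longrightarrow> n \<ge> k \<Longrightarrow>
       \<bar>x (Suc n) - \<alpha>\<bar> \<le> \<bar>x n - \<alpha>\<bar> / 2"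
    using secant_iteration_local_contraction[OF k1 I C root] by blast

  have conv: "x \<longlonglongrightarrow> \<alpha>"
    if it: "secant_iteration f k x" and w: "\<And>i. i \<le> k \<Longrightarrow> \<bar>x i - \<alpha>\<bar> \<le> \<delta>" for x
    using halving_tendsto_0[of k "\<lambda>n. x n - \<alpha>", OF half[OF it w]] by (rule LIM_zero_cancel)

  have part1: "let L = (-1) ^ (k + 1) / fact (k + 1) * ((deriv ^^ (k + 1)) f \<alpha> / deriv f \<alpha>) in
      (\<lambda>n. (x (Suc n) - \<alpha>) / (\<Prod>i\<le>k. (x (n - i) - \<alpha>))) \<longlonglongrightarrow> L \<and>
      converges_with_order x \<alpha> ?s \<and>
      (\<lambda>n. \<bar>x (Suc n) - \<alpha>\<bar> / \<bar>x n - \<alpha>\<bar> powr ?s) \<longlonglongrightarrow> \<bar>L\<bar> powr ((?s - 1) / real k)"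
    if nz: "(deriv ^^ (k + 1)) f \<alpha> \<noteq> 0" and it: "secant_iteration f k x"
      and w: "\<And>i. i \<le> k \<Longrightarrow> \<bar>x i - \<alpha>\<bar> \<le> \<delta>" and ne: "\<forall>n\<ge>k. x n \<noteq> \<alpha>" for x
  proof -
    define L where "L = (-1) ^ (k + 1) / fact (k + 1) * ((deriv ^^ (k + 1)) f \<alpha> / deriv f \<alpha>)"
    have L: "L \<noteq> 0" using nz root(2) by (simp add: L_def)
    have lim: "(\<lambda>n. (x (Suc n) - \<alpha>) / (\<Prod>i\<le>k. (x (n - i) - \<alpha>))) \<longlonglongrightarrow> L"
      unfolding L_def
      using secant_error_quotient_limit[OF k1 I C root \<delta>(2) zero it bdd[OF it w] half[OF it w]] ne
      by blast
    have ord: "(\<lambda>n. \<bar>x (Suc n) - \<alpha>\<bar> / \<bar>x n - \<alpha>\<bar> powr ?s) \<longlonglongrightarrow> \<bar>L\<bar> powr ((?s - 1) / real k)"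
      using order_from_product_recurrence[of k ?s k "\<lambda>n. x n - \<alpha>" L, OF k1 _ _ _ _ L lim]
        secant_order_bounds[OF k] secant_order_root[OF k] ne by simp
    moreover have "\<bar>L\<bar> powr ((?s - 1) / real k) > 0" using L by simp
    ultimately have "converges_with_order x \<alpha> ?s"
      unfolding converges_with_order_def using conv[OF it w] by blast
    with lim ord show ?thesis unfolding L_def[symmetric] Let_def by blast
  qed

  have part2: "(\<lambda>n. (x (Suc n) - \<alpha>) / (x n - \<alpha>) ^ 2) \<longlonglongrightarrow> (deriv ^^ 2) f \<alpha> / (2 * deriv f \<alpha>) \<and>
      ((deriv ^^ 2) f \<alpha> \<noteq> 0 \<longrightarrow> converges_with_order x \<alpha> 2) \<and>
      ((deriv ^^ 2) f \<alpha> = 0 \<longrightarrow> (\<exists>s>2. converges_with_order x \<alpha> s))"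
    if P: "degree P \<le> k" "\<forall>t\<in>I. f t = poly P t" and it: "secant_iteration f k x"
      and w: "\<And>i. i \<le> k \<Longrightarrow> \<bar>x i - \<alpha>\<bar> \<le> \<delta>" and ne: "\<forall>n\<ge>k. x n \<noteq> \<alpha>" for x P
  proof -
    have xball: "x n \<in> cball \<alpha> \<delta>" for n
      using bdd[OF it w] by (simp add: dist_real_def abs_minus_commute)
    have dP: "(deriv ^^ j) f \<alpha> = poly ((pderiv ^^ j) P) \<alpha>" for j
      using higher_deriv_eq_poly[OF I(1) _ I(2)] P(2) by blast
    have d1: "deriv f \<alpha> = poly (pderiv P) \<alpha>" using dP[of 1] by simp
    have d2: "(deriv ^^ 2) f \<alpha> = poly (pderiv (pderiv P)) \<alpha>"
      using dP[of 2] by (simp add: numeral_2_eq_2)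
    have step: "x (Suc n) = x n - poly P (x n) / poly (pderiv P) (x n)" if n: "n \<ge> k" for n
    proof -
      have "f (x n) \<noteq> 0" using zero[OF xball] ne n by blast
      then have "inj_on x {n-k..n}" using it n by (simp add: secant_iteration_def)
      then have "interp_poly f x n k = P"
        using secant_iteration_interpolates_polynomial[OF n _ P(1)] P(2) xball \<delta>(2) by blast
      moreover have "f (x n) = poly P (x n)" using P(2) xball \<delta>(2) by blast
      ultimately show ?thesis using it n by (simp add: secant_iteration_def)
    qed
    have "poly P \<alpha> = 0" using root(1) P(2) I(2) by auto
    note newton = newton_order_polynomial[OF this root(2)[unfolded d1] step conv[OF it w]]
    have "(\<lambda>n. (x (Suc n) - \<alpha>) / (x n - \<alpha>) ^ 2) \<longlonglongrightarrow> (deriv ^^ 2) f \<alpha> / (2 * deriv f \<alpha>)"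
      unfolding d1 d2 using newton(1) ne by blast
    moreover obtain m where "m \<ge> 2" "converges_with_order x \<alpha> (real m)" "m = 2 \<longleftrightarrow> (deriv ^^ 2) f \<alpha> \<noteq> 0"
      unfolding d2 using newton(2) ne by blast
    then have "(deriv ^^ 2) f \<alpha> \<noteq> 0 \<longrightarrow> converges_with_order x \<alpha> 2"
      "(deriv ^^ 2) f \<alpha> = 0 \<longrightarrow> (\<exists>s>2. converges_with_order x \<alpha> s)"
      by (auto intro!: exI[of _ "real m"])
    ultimately show ?thesis by blast
  qed

  show ?thesis
  proof (intro conjI char_root_unique_exists secant_order_bounds secant_order_less_Suc
      secant_order_tendsto k exI[of _ \<delta>] \<delta>(1) allI, goal_cases)
    case (1 x)
    show ?case
    proof (intro impI)
      assume A: "inj_on x {..k} \<and> (\<forall>i\<le>k. x i \<in> I \<and> \<bar>x i - \<alpha>\<bar> < \<delta>) \<and> secant_iteration f k x"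
      then have it: "secant_iteration f k x" and w: "\<And>i. i \<le> k \<Longrightarrow> \<bar>x i - \<alpha>\<bar> \<le> \<delta>"
        by (auto intro: less_imp_le)
      show "((deriv ^^ (k + 1)) f \<alpha> \<noteq> 0 \<longrightarrow>
           x \<longlonglongrightarrow> \<alpha> \<and>
           ((\<forall>n\<ge>k. x n \<noteq> \<alpha>) \<longrightarrow>
             (let L = (-1) ^ (k + 1) / fact (k + 1) * ((deriv ^^ (k + 1)) f \<alpha> / deriv f \<alpha>) in
               (\<lambda>n. (x (Suc n) - \<alpha>) / (\<Prod>i\<le>k. (x (n - i) - \<alpha>))) \<longlonglongrightarrow> L \<and>
               converges_with_order x \<alpha> (secant_order k) \<and>
               (\<lambda>n. \<bar>x (Suc n) - \<alpha>\<bar> / \<bar>x n - \<alpha>\<bar> powr secant_order k)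
                 \<longlonglongrightarrow> \<bar>L\<bar> powr ((secant_order k - 1) / real k)))) \<and>
        ((\<exists>P :: real poly. degree P \<le> k \<and> (\<forall>t\<in>I. f t = poly P t)) \<longrightarrow>
           x \<longlonglongrightarrow> \<alpha> \<and>
           ((\<forall>n\<ge>k. x n \<noteq> \<alpha>) \<longrightarrow>
             (\<lambda>n. (x (Suc n) - \<alpha>) / (x n - \<alpha>) ^ 2)
               \<longlonglongrightarrow> (deriv ^^ 2) f \<alpha> / (2 * deriv f \<alpha>) \<and>
             ((deriv ^^ 2) f \<alpha> \<noteq> 0 \<longrightarrow> converges_with_order x \<alpha> 2) \<and>
             ((deriv ^^ 2) f \<alpha> = 0 \<longrightarrow> (\<exists>s>2. converges_with_order x \<alpha> s))))"
        using conv[OF it w] part1[OF _ it w] part2[OF _ _ it w] by blast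
    qed
  qed
qed

end
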